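(* Let $G$ be a group, $C$ a proper subgroup of $G$, and $\preceq$ a left-preorder on $G$ relative to $C$. The following conditions are equivalent: (a) For every $\preceq$-convex jump $(K,L)$, the subgroup $K$ is normal in $L$ and the group $L/K$ is isomorphic to a subgroup of the additive group of the real numbers by an order-preserving isomorphism; that is, there is an injective group homomorphism $\tau:L/K\to\mathbb{R}$ such that, for all $\alpha,\beta\in L$, $\alpha K\,\hat{\preceq}\,\beta K$ if and only if $\tau(\alpha K)\le\tau(\beta K)$, where $\hat{\preceq}$ is the left-preorder induced by $\preceq$ on $L$ relative to $K$. (b) For every pair of positive elements $\alpha,\beta\in G$ (i.e. $1\prec\alpha$ and $1\prec\beta$) we have $\alpha\prec\beta\alpha^2$. (c) The action of $G$ on the totally ordered set $(G/C,\preceq)$ by left multiplication admits no crossing. (d) $\preceq$ is Conradian: for every pair of positive elements $\alpha,\beta\in G$ one has $\alpha\prec\beta\alpha^n$ for some $n\in\mathbb{N}$.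
   Context: A left-preorder on a group $G$ is a binary relation $\preceq$ on $G$ that is total, transitive and reflexive, that is left-invariant ($\alpha_1\preceq\alpha_2$ implies $\alpha\alpha_1\preceq\alpha\alpha_2$), and that is not the trivial relation (the one with $\alpha_1\preceq\alpha_2$ for all $\alpha_1,\alpha_2$). Write $\alpha\prec\beta$ if $\alpha\preceq\beta$ and not $\beta\preceq\alpha$. It is a left-preorder relative to $C$ if $C=\{\alpha\in G: \alpha\preceq 1\text{ and }1\preceq\alpha\}$ (always a proper subgroup). In that case $\alpha C\preceq\beta C :\Leftrightarrow \alpha\preceq\beta$ is a well-defined total order on $G/C$ invariant under left multiplication. The positive cone is $P=\{\alpha\in G:1\prec\alpha\}$; one has $G=P\sqcup P^{-1}\sqcup C$ and $\alpha\preceq\beta\Leftrightarrow\alpha^{-1}\beta\in P\cup C$. Here $0\in\mathbb{N}$. A subgroup $H$ of $G$ is $\preceq$-convex if $\alpha,\gamma\in H$, $\beta\in G$ and $\alpha\preceq\beta\preceq\gamma$ imply $\beta\in H$. A $\preceq$-convex jump is a pair $(K,L)$ of $\preceq$-convex subgroups with $K\subsetneq L$ and no $\preceq$-convex subgroup strictly between them. For $\preceq$-convex subgroups $K\subsetneq L$, the left-preorder induced by $\preceq$ on $L$ relative to $K$ is the left-preorder $\hat{\preceq}$ on $L$ relative to $K$ with positive cone $(P\cap L)\setminus K$; it is regarded as a total order on $L/K$. Let $G$ act on a totally ordered set $(X,<)$ by order-preserving bijections. A crossing for this action is $(\alpha,\beta;u,v,w)$ with $\alpha,\beta\in G$ and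 $u,v,w\in X$ such that: (1) $u<w<v$; (2) $\beta^n(u)<v$ and $u<\alpha^n(v)$ for all $n\in\mathbb{N}$; (3) there exist $N,M\in\mathbb{N}$ with $\alpha^N(v)<w<\beta^M(u)$. *)

theory Defs
  imports Complex_Main "HOL-Algebra.Left_Coset" "HOL-Algebra.Group_Action"
begin

section \<open>Left-preorders on a group\<close>

text \<open>A binary relation on the group \<open>G\<close> is rendered as a predicate \<open>lp\<close> on the whole
  element type; only its values on \<^term>\<open>carrier G\<close> matter.\<close>

definition strict :: "('a \<Rightarrow> 'a \<Rightarrow> bool) \<Rightarrow> 'a \<Rightarrow> 'a \<Rightarrow> bool" where
  "strict lp a b \<longleftrightarrow> lp a b \<and> \<not> lp b a"

text \<open>\<^const>\<open>totalp_on\<close> only compares distinct elements; together with reflexivity it is the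
  usual totality.\<close>

definition left_preorder :: "('a, 'm) monoid_scheme \<Rightarrow> ('a \<Rightarrow> 'a \<Rightarrow> bool) \<Rightarrow> bool" where
  "left_preorder G lp \<longleftrightarrow>
     totalp_on (carrier G) lp \<and> transp_on (carrier G) lp \<and> reflp_on (carrier G) lp \<and>
     (\<forall>a\<in>carrier G. \<forall>b\<in>carrier G. \<forall>g\<in>carrier G. lp a b \<longrightarrow> lp (g \<otimes>\<^bsub>G\<^esub> a) (g \<otimes>\<^bsub>G\<^esub> b)) \<and>
     \<not> (\<forall>a\<in>carrier G. \<forall>b\<in>carrier G. lp a b)"

definition left_preorder_rel ::
    "('a, 'm) monoid_scheme \<Rightarrow> 'a set \<Rightarrow> ('a \<Rightarrow> 'a \<Rightarrow> bool) \<Rightarrow> bool" where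
  "left_preorder_rel G C lp \<longleftrightarrow>
     left_preorder G lp \<and> C = {a \<in> carrier G. lp a \<one>\<^bsub>G\<^esub> \<and> lp \<one>\<^bsub>G\<^esub> a}"

definition positive_cone :: "('a, 'm) monoid_scheme \<Rightarrow> ('a \<Rightarrow> 'a \<Rightarrow> bool) \<Rightarrow> 'a set" where
  "positive_cone G lp = {a \<in> carrier G. strict lp \<one>\<^bsub>G\<^esub> a}"

text \<open>The relation on left cosets given by \<open>aC \<le> bC \<longleftrightarrow> lp a b\<close>. Existence of comparable
  representatives is the same as comparability of any given ones, see \<open>coset_le_iff\<close> below.\<close>

definition coset_le :: "('a \<Rightarrow> 'a \<Rightarrow> bool) \<Rightarrow> 'a set \<Rightarrow> 'a set \<Rightarrow> bool" where
  "coset_le lp A B \<longleftrightarrow> (\<exists>a\<in>A. \<exists>b\<in>B. lp a b)"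

definition conradian :: "('a, 'm) monoid_scheme \<Rightarrow> ('a \<Rightarrow> 'a \<Rightarrow> bool) \<Rightarrow> bool" where
  "conradian G lp \<longleftrightarrow>
     (\<forall>a\<in>positive_cone G lp. \<forall>b\<in>positive_cone G lp.
        \<exists>n::nat. strict lp a (b \<otimes>\<^bsub>G\<^esub> (a [^]\<^bsub>G\<^esub> n)))"


section \<open>Convex subgroups, jumps and induced preorders\<close>

definition convex_subgroup ::
    "('a, 'm) monoid_scheme \<Rightarrow> ('a \<Rightarrow> 'a \<Rightarrow> bool) \<Rightarrow> 'a set \<Rightarrow> bool" where
  "convex_subgroup G lp H \<longleftrightarrow>
     subgroup H G \<and>
     (\<forall>a\<in>H. \<forall>c\<in>H. \<forall>b\<in>carrier G. lp a b \<and> lp b c \<longrightarrow> b \<in> H)"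

definition convex_jump ::
    "('a, 'm) monoid_scheme \<Rightarrow> ('a \<Rightarrow> 'a \<Rightarrow> bool) \<Rightarrow> 'a set \<Rightarrow> 'a set \<Rightarrow> bool" where
  "convex_jump G lp K L \<longleftrightarrow>
     convex_subgroup G lp K \<and> convex_subgroup G lp L \<and> K \<subset> L \<and>
     \<not> (\<exists>H. convex_subgroup G lp H \<and> K \<subset> H \<and> H \<subset> L)"

text \<open>The left-preorder on \<open>L\<close> relative to \<open>K\<close> with positive cone \<open>(P \<inter> L) - K\<close>: a left-preorder
  relative to \<open>C\<close> with positive cone \<open>Q\<close> satisfies \<open>a \<le> b \<longleftrightarrow> a\<inverse> b \<in> Q \<union> C\<close>.\<close>

definition induced_preorder ::
    "('a, 'm) monoid_scheme \<Rightarrow> ('a \<Rightarrow> 'a \<Rightarrow> bool) \<Rightarrow> 'a set \<Rightarrow> 'a set \<Rightarrow> 'a \<Rightarrow> 'a \<Rightarrow> bool" where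
  "induced_preorder G lp K L a b \<longleftrightarrow>
     inv\<^bsub>G\<^esub> a \<otimes>\<^bsub>G\<^esub> b \<in> (positive_cone G lp \<inter> L - K) \<union> K"

definition real_group :: "real monoid" where
  "real_group = \<lparr>carrier = UNIV, monoid.mult = (+), one = 0\<rparr>"


section \<open>Actions on totally ordered sets and crossings\<close>

definition order_preserving_action ::
    "('a, 'm) monoid_scheme \<Rightarrow> 'x set \<Rightarrow> ('x \<Rightarrow> 'x \<Rightarrow> bool) \<Rightarrow> ('a \<Rightarrow> 'x \<Rightarrow> 'x) \<Rightarrow> bool" where
  "order_preserving_action G S lp act \<longleftrightarrow>
     group_action G S act \<and>
     totalp_on S lp \<and> transp_on S lp \<and> reflp_on S lp \<and> antisymp_on S lp \<and>
     (\<forall>g\<in>carrier G. \<forall>x\<in>S. \<forall>y\<in>S. lp x y \<longrightarrow> lp (act g x) (act g y))"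

definition crossing ::
    "('a, 'm) monoid_scheme \<Rightarrow> 'x set \<Rightarrow> ('x \<Rightarrow> 'x \<Rightarrow> bool) \<Rightarrow> ('a \<Rightarrow> 'x \<Rightarrow> 'x) \<Rightarrow>
      'a \<Rightarrow> 'a \<Rightarrow> 'x \<Rightarrow> 'x \<Rightarrow> 'x \<Rightarrow> bool" where
  "crossing G S lp act a b u v w \<longleftrightarrow>
     a \<in> carrier G \<and> b \<in> carrier G \<and> u \<in> S \<and> v \<in> S \<and> w \<in> S \<and>
     strict lp u w \<and> strict lp w v \<and>
     (\<forall>n::nat. strict lp (act (b [^]\<^bsub>G\<^esub> n) u) v \<and> strict lp u (act (a [^]\<^bsub>G\<^esub> n) v)) \<and>
     (\<exists>(N::nat) (M::nat). strict lp (act (a [^]\<^bsub>G\<^esub> N) v) w \<and> strict lp w (act (b [^]\<^bsub>G\<^esub> M) u))"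

text \<open>Left multiplication on \<open>G/C\<close>; \<^const>\<open>group_action\<close> requires functions that are
  extensional on the set acted upon, hence the restriction.\<close>

definition left_mult_action :: "('a, 'm) monoid_scheme \<Rightarrow> 'a set \<Rightarrow> 'a \<Rightarrow> 'a set \<Rightarrow> 'a set" where
  "left_mult_action G C g = (\<lambda>A\<in>lcosets\<^bsub>G\<^esub> C. g <#\<^bsub>G\<^esub> A)"


section \<open>The definitions are coherent\<close>

lemma group_real_group: "group real_group"
  by (rule groupI) (auto simp: real_group_def intro: exI[of _ "- _"])

context
  fixes G :: "('a, 'm) monoid_scheme" (structure) and C :: "'a set" and lp :: "'a \<Rightarrow> 'a \<Rightarrow> bool"
  assumes G: "group G" and P: "left_preorder_rel G C lp"
begin

interpretation group G by (rule G)

lemma cancel: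
  assumes "a \<in> carrier G" "b \<in> carrier G"
  shows "inv a \<otimes> (a \<otimes> b) = b" "a \<otimes> (inv a \<otimes> b) = b"
  using assms by (simp_all add: m_assoc[symmetric])

lemma lp_refl: "a \<in> carrier G \<Longrightarrow> lp a a"
  using P by (auto simp: left_preorder_rel_def left_preorder_def reflp_on_def)

lemma lp_trans:
  "\<lbrakk>a \<in> carrier G; b \<in> carrier G; c \<in> carrier G; lp a b; lp b c\<rbrakk> \<Longrightarrow> lp a c"
  using P transp_onD[of "carrier G" lp a b c] by (simp add: left_preorder_rel_def left_preorder_def)

lemma lp_total: "\<lbrakk>a \<in> carrier G; b \<in> carrier G\<rbrakk> \<Longrightarrow> lp a b \<or> lp b a"
  using P lp_refl[of a] totalp_onD[of "carrier G" lp a b]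
  by (cases "a = b") (auto simp: left_preorder_rel_def left_preorder_def)

lemma lp_mult: "\<lbrakk>a \<in> carrier G; b \<in> carrier G; g \<in> carrier G; lp a b\<rbrakk> \<Longrightarrow> lp (g \<otimes> a) (g \<otimes> b)"
  using P by (simp add: left_preorder_rel_def left_preorder_def)

lemma lp_mult_iff:
  assumes "a \<in> carrier G" "b \<in> carrier G" "g \<in> carrier G"
  shows "lp (g \<otimes> a) (g \<otimes> b) \<longleftrightarrow> lp a b"
proof
  assume "lp (g \<otimes> a) (g \<otimes> b)"
  then have "lp (inv g \<otimes> (g \<otimes> a)) (inv g \<otimes> (g \<otimes> b))" using assms by (simp only: lp_mult m_closed inv_closed)
  then show "lp a b" using assms by (simp add: cancel)
qed (use assms lp_mult in auto)

lemma mem_C: "c \<in> C \<longleftrightarrow> c \<in> carrier G \<and> lp c \<one> \<and> lp \<one> c"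
  using P by (auto simp: left_preorder_rel_def)

lemma subgroup_C: "subgroup C G"
proof (rule subgroupI)
  show "C \<subseteq> carrier G" using mem_C by auto
  show "C \<noteq> {}" using mem_C[of "\<one>"] lp_refl[of "\<one>"] by auto
  fix a assume a: "a \<in> C"
  show "inv a \<in> C"
    using lp_mult_iff[of "\<one>" a "inv a"] lp_mult_iff[of a "\<one>" "inv a"] a by (auto simp: mem_C)
  fix b assume b: "b \<in> C"
  have "lp (a \<otimes> b) a" "lp a (a \<otimes> b)"
    using lp_mult_iff[of b "\<one>" a] lp_mult_iff[of "\<one>" b a] a b by (auto simp: mem_C)
  then show "a \<otimes> b \<in> C"
    using a b lp_trans[of "a \<otimes> b" a "\<one>"] lp_trans[of "\<one>" a "a \<otimes> b"] by (auto simp: mem_C)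
qed

lemma C_proper: "C \<noteq> carrier G"
proof
  assume "C = carrier G"
  then have "lp a b" if "a \<in> carrier G" "b \<in> carrier G" for a b
    using that lp_trans[of a "\<one>" b] mem_C[of a] mem_C[of b] by simp
  then show False using P by (auto simp: left_preorder_rel_def left_preorder_def)
qed

lemma lp_iff_cone:
  assumes "a \<in> carrier G" "b \<in> carrier G"
  shows "lp a b \<longleftrightarrow> inv a \<otimes> b \<in> positive_cone G lp \<union> C"
proof -
  have "lp a b \<longleftrightarrow> lp \<one> (inv a \<otimes> b)"
    using lp_mult_iff[of a b "inv a"] assms by simp
  then show ?thesis using assms by (auto simp: positive_cone_def strict_def mem_C)
qed

lemma mem_lcos: 
  assumes "a \<in> carrier G" "x \<in> a <# C"
  shows "x \<in> carrier G" "lp a x" "lp x a"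
proof -
  obtain c where c: "c \<in> C" "x = a \<otimes> c" using assms by (auto simp: l_coset_def)
  then have "c \<in> carrier G" by (simp add: mem_C)
  then show "x \<in> carrier G" "lp a x" "lp x a"
    using assms c lp_mult_iff[of "\<one>" c a] lp_mult_iff[of c "\<one>" a] by (auto simp: mem_C)
qed

lemma coset_le_iff:
  assumes "a \<in> carrier G" "b \<in> carrier G"
  shows "coset_le lp (a <# C) (b <# C) \<longleftrightarrow> lp a b"
proof
  assume "coset_le lp (a <# C) (b <# C)"
  then obtain x y where xy: "x \<in> a <# C" "y \<in> b <# C" "lp x y" by (auto simp: coset_le_def)
  note x = mem_lcos[OF assms(1) xy(1)] and y = mem_lcos[OF assms(2) xy(2)]
  have "lp a y" using lp_trans[of a x y] assms x y xy by blast
  then show "lp a b" using lp_trans[of a y b] assms y by blast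
next
  assume "lp a b"
  then show "coset_le lp (a <# C) (b <# C)"
    using assms subgroup_C lcos_self by (auto simp: coset_le_def)
qed

lemma lcos_eq_if:
  assumes "a \<in> carrier G" "b \<in> carrier G" "lp a b" "lp b a"
  shows "a <# C = b <# C"
proof -
  have "inv a \<otimes> b \<in> C"
    using assms lp_mult_iff[of a b "inv a"] lp_mult_iff[of b a "inv a"] by (simp add: mem_C)
  then have "b \<in> a <# C"
    using subgroup.lcos_module_rev[OF subgroup_C G] assms by blast
  then show ?thesis using assms l_repr_independence[OF _ _ subgroup_C] by blast
qed

lemma mem_lcosets: "A \<in> lcosets C \<longleftrightarrow> (\<exists>a\<in>carrier G. A = a <# C)"
  by (auto simp: LCOSETS_def)

lemma lcos_lcos: "\<lbrakk>g \<in> carrier G; a \<in> carrier G\<rbrakk> \<Longrightarrow> g <# (a <# C) = (g \<otimes> a) <# C"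
  using subgroup.subset[OF subgroup_C] by (simp add: lcos_m_assoc)

lemma left_mult_action_lcos:
  "\<lbrakk>g \<in> carrier G; a \<in> carrier G\<rbrakk> \<Longrightarrow> left_mult_action G C g (a <# C) = (g \<otimes> a) <# C"
  by (auto simp: left_mult_action_def mem_lcosets lcos_lcos)

lemma left_mult_action_closed:
  "\<lbrakk>g \<in> carrier G; A \<in> lcosets C\<rbrakk> \<Longrightarrow> left_mult_action G C g A \<in> lcosets C"
  unfolding mem_lcosets using left_mult_action_lcos by fastforce

lemma left_mult_action_mult:
  assumes "g \<in> carrier G" "h \<in> carrier G" "A \<in> lcosets C"
  shows "left_mult_action G C (g \<otimes> h) A = left_mult_action G C g (left_mult_action G C h A)"
  using assms by (auto simp: mem_lcosets left_mult_action_lcos m_assoc)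

lemma left_mult_action_one: "A \<in> lcosets C \<Longrightarrow> left_mult_action G C \<one> A = A"
  by (auto simp: mem_lcosets left_mult_action_lcos)

lemma left_mult_action_Bij:
  assumes g: "g \<in> carrier G"
  shows "left_mult_action G C g \<in> Bij (lcosets C)"
proof -
  have "bij_betw (left_mult_action G C g) (lcosets C) (lcosets C)"
    by (rule bij_betwI[where g = "left_mult_action G C (inv g)"])
      (use g in \<open>auto simp: left_mult_action_closed left_mult_action_mult[symmetric]
         left_mult_action_one\<close>)
  then show ?thesis by (simp add: Bij_def left_mult_action_def)
qed

lemma left_mult_action_group_action: "group_action G (lcosets C) (left_mult_action G C)"
proof (intro group_action.intro group_hom.intro group_hom_axioms.intro homI)
  fix g h assume gh: "g \<in> carrier G" "h \<in> carrier G"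
  have "left_mult_action G C (g \<otimes> h)
      = compose (lcosets C) (left_mult_action G C g) (left_mult_action G C h)"
  proof (rule extensionalityI[where A = "lcosets C"])
    show "left_mult_action G C (g \<otimes> h) \<in> extensional (lcosets C)"
      by (simp add: left_mult_action_def)
  qed (use gh in \<open>auto simp: compose_def left_mult_action_mult\<close>)
  then show "left_mult_action G C (g \<otimes> h)
      = left_mult_action G C g \<otimes>\<^bsub>BijGroup (lcosets C)\<^esub> left_mult_action G C h"
    using gh by (simp add: BijGroup_def left_mult_action_Bij)
next
  fix g assume "g \<in> carrier G"
  then show "left_mult_action G C g \<in> carrier (BijGroup (lcosets C))"
    by (simp add: BijGroup_def left_mult_action_Bij)
qed (auto simp: G group_BijGroup)

lemma left_mult_order_preserving:
  "order_preserving_action G (lcosets C) (coset_le lp) (left_mult_action G C)"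
  unfolding order_preserving_action_def
proof (intro conjI)
  show "totalp_on (lcosets C) (coset_le lp)"
    by (rule totalp_onI) (clarsimp simp: mem_lcosets coset_le_iff, use lp_total in blast)
  show "transp_on (lcosets C) (coset_le lp)"
    by (rule transp_onI) (clarsimp simp: mem_lcosets coset_le_iff, use lp_trans in blast)
  show "reflp_on (lcosets C) (coset_le lp)"
    by (rule reflp_onI) (use lp_refl in \<open>auto simp: mem_lcosets coset_le_iff\<close>)
  show "antisymp_on (lcosets C) (coset_le lp)"
    by (rule antisymp_onI) (clarsimp simp: mem_lcosets coset_le_iff, rule lcos_eq_if)
qed (auto simp: left_mult_action_group_action mem_lcosets coset_le_iff left_mult_action_lcos
       lp_mult_iff)

lemma C_subset_convex:
  assumes "convex_subgroup G lp H" shows "C \<subseteq> H"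
  using assms mem_C subgroup.one_closed unfolding convex_subgroup_def by blast

lemma induced_preorder_iff:
  assumes K: "convex_subgroup G lp K" and L: "convex_subgroup G lp L" and KL: "K \<subseteq> L"
    and ab: "a \<in> L" "b \<in> L"
  shows "induced_preorder G lp K L a b \<longleftrightarrow> lp a b \<or> inv a \<otimes> b \<in> K"
proof -
  have sL: "subgroup L G" using L by (simp add: convex_subgroup_def)
  have "a \<in> carrier G" "b \<in> carrier G" "inv a \<otimes> b \<in> L"
    using ab sL by (auto simp: subgroup.mem_carrier subgroup.m_closed subgroup.m_inv_closed)
  then show ?thesis
    using lp_iff_cone[of a b] C_subset_convex[OF K] by (auto simp: induced_preorder_def)
qed

lemma induced_preorder_left_preorder:
  assumes K: "convex_subgroup G lp K" and L: "convex_subgroup G lp L" and KL: "K \<subset> L"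
  shows "left_preorder_rel (G\<lparr>carrier := L\<rparr>) K (induced_preorder G lp K L)"
    and "positive_cone (G\<lparr>carrier := L\<rparr>) (induced_preorder G lp K L) = positive_cone G lp \<inter> L - K"
proof -
  have sK: "subgroup K G" and sL: "subgroup L G" using K L by (auto simp: convex_subgroup_def)
  have Lc: "x \<in> carrier G" if "x \<in> L" for x using that sL by (simp add: subgroup.mem_carrier)
  have Kc: "x \<in> carrier G" if "x \<in> K" for x using that sK by (simp add: subgroup.mem_carrier)
  note iff = induced_preorder_iff[OF K L psubset_imp_subset[OF KL]]
  have invK: "inv a \<otimes> b \<in> K \<longleftrightarrow> inv b \<otimes> a \<in> K" if "a \<in> L" "b \<in> L" for a b
  proof -
    have "inv (inv a \<otimes> b) = inv b \<otimes> a" "inv (inv b \<otimes> a) = inv a \<otimes> b"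
      using that Lc by (simp_all add: inv_mult_group)
    then show ?thesis
      using subgroup.m_inv_closed[OF sK, of "inv a \<otimes> b"] subgroup.m_inv_closed[OF sK, of "inv b \<otimes> a"]
      by auto
  qed
  have pos: "induced_preorder G lp K L a b \<longleftrightarrow> lp \<one> (inv a \<otimes> b) \<or> inv a \<otimes> b \<in> K"
    if "a \<in> L" "b \<in> L" for a b
    using that iff[of a b] Lc lp_mult_iff[of a b "inv a"] by simp
  have mulP: "lp \<one> (x \<otimes> y) \<or> x \<otimes> y \<in> K"
    if xy: "x \<in> L" "y \<in> L" "lp \<one> x \<or> x \<in> K" "lp \<one> y \<or> y \<in> K" for x y
  proof (rule ccontr)
    assume n: "\<not> ?thesis"
    have c: "x \<in> carrier G" "y \<in> carrier G" "x \<otimes> y \<in> L"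
      using xy Lc sL by (auto simp: subgroup.m_closed)
    have le1: "lp (x \<otimes> y) \<one>" using n c lp_total[of "x \<otimes> y" "\<one>"] by auto
    consider "x \<in> K" "y \<in> K" | "lp \<one> x" "lp \<one> y" | "x \<in> K" "lp \<one> y" | "lp \<one> x" "y \<in> K"
      using xy by blast
    then show False
    proof cases
      case 1 then show False using n sK by (simp add: subgroup.m_closed)
    next
      case 2
      have "lp x (x \<otimes> y)" using lp_mult_iff[of "\<one>" y x] 2 c by simp
      then show False using lp_trans[of "\<one>" x "x \<otimes> y"] 2 n c by simp
    next
      case 3
      have "lp x (x \<otimes> y)" using lp_mult_iff[of "\<one>" y x] 3 c by simp
      then have "x \<otimes> y \<in> K"
        using K 3 le1 subgroup.one_closed[OF sK] c unfolding convex_subgroup_def by (metis m_closed)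
      then show False using n by blast
    next
      case 4
      have "lp y (inv x)" using lp_mult_iff[of "x \<otimes> y" "\<one>" "inv x"] le1 c
        by (simp add: m_assoc[symmetric])
      moreover have "lp (inv x) \<one>" using lp_mult_iff[of "\<one>" x "inv x"] 4 c by simp
      ultimately have "inv x \<in> K"
        using K 4 subgroup.one_closed[OF sK] c unfolding convex_subgroup_def by (metis inv_closed)
      then have "x \<in> K" using subgroup.m_inv_closed[OF sK] c by fastforce
      then show False using n 4 sK by (simp add: subgroup.m_closed)
    qed
  qed
  have oneK: "\<one> \<in> K" and oneL: "\<one> \<in> L" using sK sL by (auto simp: subgroup.one_closed)
  have ind1: "induced_preorder G lp K L a \<one> \<longleftrightarrow> lp a \<one> \<or> a \<in> K" if "a \<in> L" for a
    using iff[of a "\<one>"] that oneL invK[of a "\<one>"] Lc by simp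
  have ind2: "induced_preorder G lp K L \<one> a \<longleftrightarrow> lp \<one> a \<or> a \<in> K" if "a \<in> L" for a
    using iff[of "\<one>" a] that oneL Lc by simp
  have CK: "C \<subseteq> K" by (rule C_subset_convex[OF K])
  have Keq: "K = {a \<in> L. induced_preorder G lp K L a \<one> \<and> induced_preorder G lp K L \<one> a}"
    using ind1 ind2 CK KL mem_C Lc by blast
  show "left_preorder_rel (G\<lparr>carrier := L\<rparr>) K (induced_preorder G lp K L)"
    unfolding left_preorder_rel_def left_preorder_def
  proof (intro conjI)
    show "totalp_on (carrier (G\<lparr>carrier := L\<rparr>)) (induced_preorder G lp K L)"
      by (rule totalp_onI) (simp add: iff, use lp_total Lc in blast)
    show "reflp_on (carrier (G\<lparr>carrier := L\<rparr>)) (induced_preorder G lp K L)"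
      by (rule reflp_onI) (use iff lp_refl Lc in auto)
    show "transp_on (carrier (G\<lparr>carrier := L\<rparr>)) (induced_preorder G lp K L)"
    proof (rule transp_onI, simp)
      fix a b c assume abc: "a \<in> L" "b \<in> L" "c \<in> L"
        and "induced_preorder G lp K L a b" "induced_preorder G lp K L b c"
      then have "lp \<one> (inv a \<otimes> b) \<or> inv a \<otimes> b \<in> K" "lp \<one> (inv b \<otimes> c) \<or> inv b \<otimes> c \<in> K"
        using pos by auto
      moreover have "inv a \<otimes> b \<in> L" "inv b \<otimes> c \<in> L"
        using abc sL by (auto simp: subgroup.m_closed subgroup.m_inv_closed)
      moreover have "(inv a \<otimes> b) \<otimes> (inv b \<otimes> c) = inv a \<otimes> c"
        using abc Lc by (simp add: m_assoc cancel)
      ultimately show "induced_preorder G lp K L a c"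
        using mulP[of "inv a \<otimes> b" "inv b \<otimes> c"] pos abc by simp
    qed
    show "\<forall>a\<in>carrier (G\<lparr>carrier := L\<rparr>). \<forall>b\<in>carrier (G\<lparr>carrier := L\<rparr>).
        \<forall>g\<in>carrier (G\<lparr>carrier := L\<rparr>). induced_preorder G lp K L a b \<longrightarrow>
          induced_preorder G lp K L (g \<otimes>\<^bsub>G\<lparr>carrier := L\<rparr>\<^esub> a) (g \<otimes>\<^bsub>G\<lparr>carrier := L\<rparr>\<^esub> b)"
    proof (simp, intro ballI impI)
      fix a b g assume abg: "a \<in> L" "b \<in> L" "g \<in> L" and i: "induced_preorder G lp K L a b"
      have "inv (g \<otimes> a) \<otimes> (g \<otimes> b) = inv a \<otimes> b"
        using abg Lc by (simp add: inv_mult_group m_assoc cancel)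
      then show "induced_preorder G lp K L (g \<otimes> a) (g \<otimes> b)"
        using i by (simp add: induced_preorder_def)
    qed
    show "\<not> (\<forall>a\<in>carrier (G\<lparr>carrier := L\<rparr>). \<forall>b\<in>carrier (G\<lparr>carrier := L\<rparr>).
        induced_preorder G lp K L a b)"
      using Keq KL oneL by auto
    show "K = {a \<in> carrier (G\<lparr>carrier := L\<rparr>).
        induced_preorder G lp K L a \<one>\<^bsub>G\<lparr>carrier := L\<rparr>\<^esub> \<and>
        induced_preorder G lp K L \<one>\<^bsub>G\<lparr>carrier := L\<rparr>\<^esub> a}"
      using Keq by simp
  qed
  show "positive_cone (G\<lparr>carrier := L\<rparr>) (induced_preorder G lp K L)
      = positive_cone G lp \<inter> L - K"
  proof (rule Set.set_eqI)
    fix a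
    have "a \<in> positive_cone G lp \<inter> L - K \<longleftrightarrow> a \<in> L \<and> a \<notin> K \<and> lp \<one> a \<and> \<not> lp a \<one>"
      using Lc by (auto simp: positive_cone_def strict_def)
    moreover have "a \<in> positive_cone (G\<lparr>carrier := L\<rparr>) (induced_preorder G lp K L) \<longleftrightarrow>
        a \<in> L \<and> a \<notin> K \<and> lp \<one> a \<and> \<not> lp a \<one>"
      using ind1[of a] ind2[of a] by (auto simp: positive_cone_def strict_def)
    ultimately show "a \<in> positive_cone (G\<lparr>carrier := L\<rparr>) (induced_preorder G lp K L) \<longleftrightarrow>
        a \<in> positive_cone G lp \<inter> L - K" by simp
  qed
qed

end

end

theory Submission
  imports Defs
begin

text \<open>Call (b) the square property. A failure \<open>b a\<^sup>2 \<preceq> a\<close> of it is a crossing for \<open>b\<close> and \<open>b a\<close>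
  between the cosets of \<open>1\<close> and \<open>a\<close>. A crossing at \<open>w\<close>, after passing to powers \<open>A\<close>, \<open>B\<close> of its
  two elements, contradicts the Conradian property of the pair \<open>w\<inverse> B w\<close>, \<open>w\<inverse> B A w\<close>.
  Under the square property the elements bounded on both sides by powers of a positive \<open>a\<close> form
  a convex subgroup. Hence at a convex jump \<open>(K, L)\<close> every positive element of \<open>L - K\<close> has powers
  exceeding any given element of \<open>L\<close>; this gives normality of \<open>K\<close> in \<open>L\<close> and invariance of the
  order on \<open>L/K\<close> under right translations, and Hoelder's construction embeds \<open>L/K\<close> into the
  reals. Conversely, two positive elements are compared in the jump determined by the larger one.\<close>

section \<open>Auxiliary facts on real numbers and groups\<close>

text \<open>If \<open>s\<close> and \<open>t\<close> differed, the multiples of their distance would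
  outgrow \<open>c\<close>. This absorbs the bounded rounding errors of the integer floors used for
  the embedding.\<close>

lemma real_eq_if_multiples_close:
  fixes s t :: real
  assumes "\<And>n::nat. n > 0 \<Longrightarrow> \<bar>real n * s - real n * t\<bar> \<le> c"
  shows "s = t"
proof (rule ccontr)
  assume "s \<noteq> t"
  \<comment> \<open>\<open>max c 0\<close> also covers a negative \<open>c\<close> and forces
    \<open>n > 0\<close>.\<close>
  then obtain n :: nat where n: "max c 0 < real n * \<bar>s - t\<bar>"
    using reals_Archimedean3[of "\<bar>s - t\<bar>"] by (auto dest!: spec[of _ "max c 0"])
  then have "n > 0" by (cases n) auto
  moreover have "real n * \<bar>s - t\<bar> = \<bar>real n * s - real n * t\<bar>"
    by (simp add: abs_mult flip: right_diff_distrib)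
  ultimately show False using assms[of n] n by simp
qed

lemma (in group) inv_cancel:
  assumes "x \<in> carrier G" "y \<in> carrier G"
  shows "x \<otimes> (inv x \<otimes> y) = y" "inv x \<otimes> (x \<otimes> y) = y"
  using assms by (simp_all add: m_assoc[symmetric])

lemma (in group) conj_nat_pow:
  assumes "x \<in> carrier G" "w \<in> carrier G"
  shows "(inv w \<otimes> x \<otimes> w) [^] (n::nat) = inv w \<otimes> x [^] n \<otimes> w"
proof (induction n)
  case (Suc n)
  have "(inv w \<otimes> x [^] n \<otimes> w) \<otimes> (inv w \<otimes> x \<otimes> w) = inv w \<otimes> (x [^] n \<otimes> x) \<otimes> w"
    using assms by (simp add: m_assoc inv_cancel)
  then show ?case using Suc by simp
qed (use assms in simp)

section \<open>Order calculus of a left-preorder\<close>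

locale relative_left_preorder = group G for G (structure) +
  fixes C :: "'a set" and lp :: "'a \<Rightarrow> 'a \<Rightarrow> bool" (infix \<open>\<preceq>\<close> 50)
  assumes preorder: "left_preorder_rel G C (\<preceq>)"
begin

abbreviation less (infix \<open>\<prec>\<close> 50) where "x \<prec> y \<equiv> strict (\<preceq>) x y"

abbreviation "P \<equiv> positive_cone G (\<preceq>)"

lemmas le_refl = lp_refl[OF is_group preorder]
  and le_trans = lp_trans[OF is_group preorder]
  and le_total = lp_total[OF is_group preorder]
  and mult_le_iff = lp_mult_iff[OF is_group preorder]
  and mem_C = mem_C[OF is_group preorder]
  and subgroup_C = subgroup_C[OF is_group preorder]
  and C_subset_convex = C_subset_convex[OF is_group preorder]

lemma less_iff: "\<lbrakk>x \<in> carrier G; y \<in> carrier G\<rbrakk> \<Longrightarrow> x \<prec> y \<longleftrightarrow> \<not> y \<preceq> x"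
  using le_total unfolding strict_def by blast

lemma less_imp_le: "x \<prec> y \<Longrightarrow> x \<preceq> y"
  by (simp add: strict_def)

lemma mult_less_iff:
  "\<lbrakk>x \<in> carrier G; y \<in> carrier G; g \<in> carrier G\<rbrakk> \<Longrightarrow> g \<otimes> x \<prec> g \<otimes> y \<longleftrightarrow> x \<prec> y"
  by (simp add: strict_def mult_le_iff)

lemma le_less_trans:
  "\<lbrakk>x \<preceq> y; y \<prec> z; x \<in> carrier G; y \<in> carrier G; z \<in> carrier G\<rbrakk> \<Longrightarrow> x \<prec> z"
  unfolding strict_def using le_trans by blast

lemma less_le_trans:
  "\<lbrakk>x \<prec> y; y \<preceq> z; x \<in> carrier G; y \<in> carrier G; z \<in> carrier G\<rbrakk> \<Longrightarrow> x \<prec> z"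
  unfolding strict_def using le_trans by blast

lemma less_trans:
  "\<lbrakk>x \<prec> y; y \<prec> z; x \<in> carrier G; y \<in> carrier G; z \<in> carrier G\<rbrakk> \<Longrightarrow> x \<prec> z"
  unfolding strict_def using le_trans by blast

lemma mem_P: "x \<in> P \<longleftrightarrow> x \<in> carrier G \<and> \<one> \<prec> x"
  by (simp add: positive_cone_def)

lemma inv_mult_le_iff:
  assumes "x \<in> carrier G" "y \<in> carrier G" "z \<in> carrier G"
  shows "inv x \<otimes> y \<preceq> z \<longleftrightarrow> y \<preceq> x \<otimes> z" "z \<preceq> inv x \<otimes> y \<longleftrightarrow> x \<otimes> z \<preceq> y"
  using mult_le_iff[of "inv x \<otimes> y" z x] mult_le_iff[of z "inv x \<otimes> y" x] assms
  by (simp_all add: m_assoc[symmetric])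

lemma inv_mult_less_iff:
  assumes "x \<in> carrier G" "y \<in> carrier G" "z \<in> carrier G"
  shows "inv x \<otimes> y \<prec> z \<longleftrightarrow> y \<prec> x \<otimes> z" "z \<prec> inv x \<otimes> y \<longleftrightarrow> x \<otimes> z \<prec> y"
  using assms by (simp_all add: strict_def inv_mult_le_iff)

lemma inv_le_iff:
  assumes "x \<in> carrier G" "z \<in> carrier G"
  shows "inv x \<preceq> z \<longleftrightarrow> \<one> \<preceq> x \<otimes> z" "z \<preceq> inv x \<longleftrightarrow> x \<otimes> z \<preceq> \<one>"
  using inv_mult_le_iff[of x "\<one>" z] assms by simp_all

lemma P_mult: "\<lbrakk>x \<in> P; y \<in> P\<rbrakk> \<Longrightarrow> x \<otimes> y \<in> P"
  using mult_less_iff[of "\<one>" y x] less_trans[of "\<one>" x "x \<otimes> y"] by (simp add: mem_P)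

lemma P_pow: "\<lbrakk>x \<in> P; n > 0\<rbrakk> \<Longrightarrow> x [^] (n::nat) \<in> P"
proof (induction n)
  case (Suc n)
  then show ?case using P_mult[of "x [^] n" x] by (cases n) (auto simp: mem_P)
qed simp

lemma pow_mono_exp:
  assumes "x \<in> carrier G" "\<one> \<preceq> x" "m \<le> n"
  shows "x [^] (m::nat) \<preceq> x [^] n"
  using assms(3)
proof (induction n rule: dec_induct)
  case (step n)
  have "x [^] n \<preceq> x [^] n \<otimes> x" using mult_le_iff[of "\<one>" x "x [^] n"] assms by simp
  then show ?case using step le_trans[of "x [^] m" "x [^] n" "x [^] n \<otimes> x"] assms by simp
qed (use assms le_refl in simp)

lemma pow_strict_mono_exp:
  assumes "x \<in> P" "m < n"
  shows "x [^] (m::nat) \<prec> x [^] n"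
proof -
  have x: "x \<in> carrier G" "\<one> \<prec> x" using assms by (auto simp: mem_P)
  have "x [^] m \<prec> x [^] m \<otimes> x" using mult_less_iff[of "\<one>" x "x [^] m"] x by simp
  moreover have "x [^] m \<otimes> x \<preceq> x [^] n"
    using pow_mono_exp[of x "Suc m" n] x assms(2) by (simp add: strict_def)
  ultimately show ?thesis using less_le_trans x by simp
qed

text \<open>Conjugation by \<open>w\<close> shifts the base point from \<open>C\<close> to
  \<open>w C\<close>: positivity of the conjugate records that \<open>x\<close> moves
  \<open>w\<close> up.\<close>

lemma conj_mem_P_iff:
  assumes "x \<in> carrier G" "w \<in> carrier G"
  shows "inv w \<otimes> x \<otimes> w \<in> P \<longleftrightarrow> w \<prec> x \<otimes> w"
  using inv_mult_less_iff(2)[of w "x \<otimes> w" "\<one>"] assms by (simp add: mem_P m_assoc)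

section \<open>Crossings, the square property and the Conradian property\<close>

abbreviation has_crossing where
  "has_crossing \<equiv> \<exists>a b u v w.
     crossing G (lcosets C) (coset_le (\<preceq>)) (left_mult_action G C) a b u v w"

lemma strict_coset_le_iff:
  "\<lbrakk>x \<in> carrier G; y \<in> carrier G\<rbrakk> \<Longrightarrow> strict (coset_le (\<preceq>)) (x <# C) (y <# C) \<longleftrightarrow> x \<prec> y"
  by (simp add: strict_def coset_le_iff[OF is_group preorder])

lemma crossing_lcosets_iff:
  assumes "u \<in> carrier G" "v \<in> carrier G" "w \<in> carrier G"
  shows "crossing G (lcosets C) (coset_le (\<preceq>)) (left_mult_action G C) a b (u <# C) (v <# C) (w <# C)
    \<longleftrightarrow> a \<in> carrier G \<and> b \<in> carrier G \<and> u \<prec> w \<and> w \<prec> v \<and>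
      (\<forall>n::nat. b [^] n \<otimes> u \<prec> v \<and> u \<prec> a [^] n \<otimes> v) \<and>
      (\<exists>(N::nat) (M::nat). a [^] N \<otimes> v \<prec> w \<and> w \<prec> b [^] M \<otimes> u)"
proof -
  have "g <# C \<in> lcosets C" if "g \<in> carrier G" for g
    using that by (auto simp: LCOSETS_def)
  then show ?thesis
    using assms
    by (auto simp: crossing_def left_mult_action_lcos[OF is_group preorder] strict_coset_le_iff)
qed

text \<open>Let \<open>A = a ^ N\<close> take \<open>v\<close> below \<open>w\<close> and
  \<open>B = b ^ M\<close> take \<open>u\<close> above \<open>w\<close>. Both \<open>B\<close> and
  \<open>B A\<close> move \<open>w\<close> up, so their conjugates by \<open>w\<close> are positive.
  The Conradian property yields \<open>B w \<prec> B A B ^ n w\<close> for some \<open>n\<close>,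
  that is \<open>w \<prec> A B ^ n w\<close>; but \<open>B ^ n w \<prec> v\<close> gives
  \<open>A B ^ n w \<prec> A v \<prec> w\<close>.\<close>

lemma crossing_imp_not_conradian:
  assumes cross: has_crossing
  shows "\<not> conradian G (\<preceq>)"
proof
  assume con: "conradian G (\<preceq>)"
  obtain a b U V W where
    cr: "crossing G (lcosets C) (coset_le (\<preceq>)) (left_mult_action G C) a b U V W"
    using cross by blast
  then obtain u v w where uvw: "u \<in> carrier G" "v \<in> carrier G" "w \<in> carrier G"
      and "U = u <# C" "V = v <# C" "W = w <# C"
    unfolding crossing_def mem_lcosets[OF is_group preorder] by blast
  with cr obtain N M where ab: "a \<in> carrier G" "b \<in> carrier G"
      and order: "u \<prec> w" "w \<prec> v"
      and bounds: "\<And>n. b [^] (n::nat) \<otimes> u \<prec> v" "\<And>n. u \<prec> a [^] (n::nat) \<otimes> v"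
      and moves: "a [^] (N::nat) \<otimes> v \<prec> w" "w \<prec> b [^] (M::nat) \<otimes> u"
    by (auto simp: crossing_lcosets_iff)
  define A B where "A = a [^] N" and "B = b [^] M"
  have [simp]: "A \<in> carrier G" "B \<in> carrier G" using ab by (auto simp: A_def B_def)
  note [simp] = uvw
  have AB: "A \<otimes> v \<prec> w" "w \<prec> B \<otimes> u" using moves by (auto simp: A_def B_def)
  have Bn: "B [^] (n::nat) \<otimes> u \<prec> v" for n
    using bounds(1)[of "M * n"] ab by (simp add: B_def nat_pow_pow)
  \<comment> \<open>The exponent \<open>2 N\<close> is used so that \<open>A w\<close>, which lies
    above \<open>A A v\<close>, stays above \<open>u\<close>; then \<open>B\<close> takes
    \<open>A w\<close> above \<open>B u\<close> and hence above \<open>w\<close>.\<close>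
  have "u \<prec> A \<otimes> A \<otimes> v"
    using bounds(2)[of "N + N"] ab by (simp add: A_def nat_pow_mult)
  moreover have "A \<otimes> A \<otimes> v \<prec> A \<otimes> w" using AB by (simp add: m_assoc mult_less_iff)
  ultimately have uAw: "u \<prec> A \<otimes> w" using less_trans[of u "A \<otimes> A \<otimes> v"] by simp
  have "B \<otimes> u \<prec> B \<otimes> w" using order by (simp add: mult_less_iff)
  then have "w \<prec> B \<otimes> w" using AB less_trans[of w "B \<otimes> u"] by simp
  then have x: "inv w \<otimes> B \<otimes> w \<in> P" by (simp add: conj_mem_P_iff)
  have "B \<otimes> u \<prec> B \<otimes> A \<otimes> w" using uAw by (simp add: mult_less_iff m_assoc)
  then have "w \<prec> B \<otimes> A \<otimes> w" using AB less_trans[of w "B \<otimes> u"] by simp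
  then have y: "inv w \<otimes> (B \<otimes> A) \<otimes> w \<in> P" by (simp add: conj_mem_P_iff)
  obtain n :: nat where
    "inv w \<otimes> B \<otimes> w \<prec> (inv w \<otimes> (B \<otimes> A) \<otimes> w) \<otimes> (inv w \<otimes> B \<otimes> w) [^] n"
    using con x y unfolding conradian_def by blast
  also have "(inv w \<otimes> (B \<otimes> A) \<otimes> w) \<otimes> (inv w \<otimes> B \<otimes> w) [^] n
      = inv w \<otimes> (B \<otimes> (A \<otimes> (B [^] n \<otimes> w)))"
    using conj_nat_pow[of B w n] by (simp add: m_assoc inv_cancel)
  finally have less: "w \<prec> A \<otimes> (B [^] n \<otimes> w)" by (simp add: m_assoc mult_less_iff)
  have "B [^] n \<otimes> w \<prec> B [^] n \<otimes> (B \<otimes> u)" using AB by (simp add: mult_less_iff)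
  also have "B [^] n \<otimes> (B \<otimes> u) = B [^] Suc n \<otimes> u" by (simp add: m_assoc)
  finally have "B [^] n \<otimes> w \<prec> v" using less_trans[OF _ Bn[of "Suc n"]] by simp
  then have "A \<otimes> (B [^] n \<otimes> w) \<prec> A \<otimes> v" by (simp add: mult_less_iff)
  then have "A \<otimes> (B [^] n \<otimes> w) \<prec> w" using AB less_trans[of _ "A \<otimes> v"] by simp
  with less show False by (simp add: strict_def)
qed

definition square_property where
  "square_property \<longleftrightarrow> (\<forall>a\<in>P. \<forall>b\<in>P. a \<prec> b \<otimes> (a [^] (2::nat)))"

text \<open>If \<open>b a\<^sup>2 \<preceq> a\<close>, then \<open>b a\<close> pushes the interval from \<open>C\<close> to \<open>a C\<close> up into its part above
  \<open>b a C\<close> and \<open>b\<close> pushes it down into its part below \<open>b a C\<close>.\<close>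

lemma no_crossing_imp_square_property:
  assumes "\<not> has_crossing"
  shows square_property
  unfolding square_property_def
proof (intro ballI, rule ccontr)
  fix a b assume "a \<in> P" "b \<in> P" and n: "\<not> a \<prec> b \<otimes> a [^] (2::nat)"
  then have ab[simp]: "a \<in> carrier G" "b \<in> carrier G" and pos: "\<one> \<prec> a" "\<one> \<prec> b"
    by (auto simp: mem_P)
  have baa: "b \<otimes> a \<otimes> a \<preceq> a" using n by (simp add: less_iff numeral_2_eq_2 m_assoc)
  have "b \<prec> b \<otimes> a" using mult_less_iff[of "\<one>" a b] pos by simp
  then have one_ba: "\<one> \<prec> b \<otimes> a" using less_trans[of "\<one>" b] pos by simp
  have ba_baa: "b \<otimes> a \<prec> b \<otimes> a \<otimes> a" using mult_less_iff[of "\<one>" a "b \<otimes> a"] pos by simp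
  then have ba_a: "b \<otimes> a \<prec> a" using baa less_le_trans[of "b \<otimes> a" "b \<otimes> a \<otimes> a"] by simp
  \<comment> \<open>Left translations of \<open>b a a \<preceq> a\<close> by powers of
    \<open>b a\<close> form a descending chain, so the orbit of \<open>a\<close> under
    \<open>b a\<close> never exceeds \<open>a\<close>.\<close>
  have up: "(b \<otimes> a) [^] n \<otimes> a \<preceq> a" for n :: nat
  proof (induction n)
    case (Suc n)
    have "(b \<otimes> a) [^] Suc n \<otimes> a \<preceq> (b \<otimes> a) [^] n \<otimes> a"
      using baa by (simp add: mult_le_iff m_assoc)
    then show ?case
      using Suc le_trans[of "(b \<otimes> a) [^] Suc n \<otimes> a" "(b \<otimes> a) [^] n \<otimes> a" a] by simp
  qed (simp add: le_refl)
  have "crossing G (lcosets C) (coset_le (\<preceq>)) (left_mult_action G C) b (b \<otimes> a)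
      (\<one> <# C) (a <# C) ((b \<otimes> a) <# C)"
  proof (subst crossing_lcosets_iff; (intro conjI allI exI)?)
    fix n :: nat
    have "(b \<otimes> a) [^] n \<prec> (b \<otimes> a) [^] n \<otimes> a"
      using pos mult_less_iff[of "\<one>" a "(b \<otimes> a) [^] n"] by simp
    then show "(b \<otimes> a) [^] n \<otimes> \<one> \<prec> a"
      using less_le_trans[OF _ up[of n]] by simp
    have "b [^] n \<prec> b [^] n \<otimes> a" using pos mult_less_iff[of "\<one>" a "b [^] n"] by simp
    moreover have "\<one> \<preceq> b [^] n" using pow_mono_exp[of b 0 n] pos by (simp add: strict_def)
    ultimately show "\<one> \<prec> b [^] n \<otimes> a" using le_less_trans[of "\<one>" "b [^] n"] by simp
  next
    \<comment> \<open>A single application of \<open>b\<close> to \<open>a\<close>, or of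
      \<open>b a\<close> to \<open>1\<close>, lands exactly on the middle point \<open>b a\<close>;
      the second application makes both inequalities strict.\<close>
    show "b [^] (2::nat) \<otimes> a \<prec> b \<otimes> a"
      using ba_a by (simp add: numeral_2_eq_2 m_assoc mult_less_iff)
    show "b \<otimes> a \<prec> (b \<otimes> a) [^] (2::nat) \<otimes> \<one>"
      using mult_less_iff[of "\<one>" "b \<otimes> a" "b \<otimes> a"] one_ba by (simp add: numeral_2_eq_2)
  qed (use one_ba ba_a in simp_all)
  then show False using assms by blast
qed

lemma square_property_imp_conradian: "square_property \<Longrightarrow> conradian G (\<preceq>)"
  unfolding square_property_def conradian_def by blast

end

section \<open>Archimedean left-preorders\<close>

text \<open>The abstract form of a convex jump under the square property; it is interpreted later
  with \<open>L\<close> as the group and \<open>K\<close> in the role of \<open>C\<close>.\<close>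

locale archimedean_left_preorder = relative_left_preorder +
  assumes C_normal: "C \<lhd> G"
    and archimedean: "\<lbrakk>a \<in> P; b \<in> carrier G\<rbrakk> \<Longrightarrow> \<exists>n::nat. b \<preceq> a [^] n"
begin

section \<open>Invariance under right translations\<close>

lemma conj_mem_C:
  assumes "c \<in> C" "h \<in> carrier G"
  shows "inv h \<otimes> c \<otimes> h \<in> C"
  using normal.inv_op_closed1[OF C_normal] assms by blast

text \<open>By normality the conjugate \<open>y\<close> is not in \<open>C\<close>, so otherwise
  \<open>inv y\<close> is positive. For large \<open>k\<close> this gives
  \<open>inv h \<preceq> inv y ^ k = inv h x ^ (-k) h\<close>, hence
  \<open>x ^ k \<preceq> h\<close>. But \<open>h \<preceq> x ^ m\<close> for some \<open>m\<close>,
  and \<open>k\<close> is chosen above \<open>m\<close>.\<close>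

lemma conj_mem_P:
  assumes x: "x \<in> P" and h: "h \<in> carrier G"
  shows "inv h \<otimes> x \<otimes> h \<in> P"
proof (rule ccontr)
  define y where "y = inv h \<otimes> x \<otimes> h"
  assume "inv h \<otimes> x \<otimes> h \<notin> P"
  have [simp]: "x \<in> carrier G" "y \<in> carrier G" "h \<in> carrier G" using x h by (auto simp: mem_P y_def)
  have inv_y: "inv y = inv h \<otimes> inv x \<otimes> h" by (simp add: y_def inv_mult_group m_assoc)
  have "inv (inv h) \<otimes> y \<otimes> inv h = x" by (simp add: y_def m_assoc inv_cancel)
  then have "y \<notin> C" using conj_mem_C[of y "inv h"] x by (auto simp: mem_C mem_P strict_def)
  moreover have "y \<notin> P" using \<open>inv h \<otimes> x \<otimes> h \<notin> P\<close> by (simp add: y_def)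
  ultimately have "\<not> \<one> \<preceq> y" by (auto simp: mem_C mem_P strict_def)
  then have "inv y \<in> P" using inv_le_iff(2)[of y "\<one>"] inv_le_iff(1)[of y "\<one>"] le_total[of y "\<one>"]
    inv_mult_less_iff(2)[of y "\<one>" "\<one>"] by (simp add: mem_P less_iff)
  then obtain n :: nat where n: "inv h \<preceq> inv y [^] n" using archimedean[of "inv y" "inv h"] by auto
  obtain m :: nat where m: "h \<preceq> x [^] m" using archimedean[OF x h] by blast
  define k where "k = Suc (max m n)"
  have "inv y [^] n \<preceq> inv y [^] k"
    using \<open>inv y \<in> P\<close> by (intro pow_mono_exp) (auto simp: mem_P k_def less_imp_le)
  then have "inv h \<preceq> inv y [^] k" using n le_trans[of "inv h" "inv y [^] n"] by simp
  also have "inv y [^] k = inv h \<otimes> (inv (x [^] k) \<otimes> h)"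
    using conj_nat_pow[of "inv x" h k] by (simp add: inv_y nat_pow_inv m_assoc)
  finally have "x [^] k \<preceq> h" by (simp add: inv_mult_le_iff inv_cancel)
  then have "x [^] k \<preceq> x [^] m" using m le_trans[of _ h] by simp
  moreover have "x [^] m \<prec> x [^] k" using x by (intro pow_strict_mono_exp) (auto simp: k_def)
  ultimately show False by (simp add: strict_def)
qed

lemma mult_right_le:
  assumes "x \<preceq> y" and [simp]: "x \<in> carrier G" "y \<in> carrier G" "h \<in> carrier G"
  shows "x \<otimes> h \<preceq> y \<otimes> h"
proof -
  have "inv (x \<otimes> h) \<otimes> (y \<otimes> h) = inv h \<otimes> (inv x \<otimes> y) \<otimes> h"
    by (simp add: inv_mult_group m_assoc)
  moreover have "inv x \<otimes> y \<in> P \<union> C" using assms lp_iff_cone[OF is_group preorder] by blast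
  ultimately have "inv (x \<otimes> h) \<otimes> (y \<otimes> h) \<in> P \<union> C" using conj_mem_P conj_mem_C by auto
  then show ?thesis using lp_iff_cone[OF is_group preorder] by simp
qed

lemma mult_right_le_iff:
  assumes "x \<in> carrier G" "y \<in> carrier G" "h \<in> carrier G"
  shows "x \<otimes> h \<preceq> y \<otimes> h \<longleftrightarrow> x \<preceq> y"
  using mult_right_le[of x y h] mult_right_le[of "x \<otimes> h" "y \<otimes> h" "inv h"] assms
  by (auto simp: m_assoc)

lemma mult_mono:
  "\<lbrakk>a \<preceq> b; c \<preceq> d; a \<in> carrier G; b \<in> carrier G; c \<in> carrier G; d \<in> carrier G\<rbrakk>
    \<Longrightarrow> a \<otimes> c \<preceq> b \<otimes> d"
  using le_trans[of "a \<otimes> c" "b \<otimes> c" "b \<otimes> d"] by (simp add: mult_right_le_iff mult_le_iff)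

lemma mult_strict_mono:
  "\<lbrakk>a \<prec> b; c \<prec> d; a \<in> carrier G; b \<in> carrier G; c \<in> carrier G; d \<in> carrier G\<rbrakk>
    \<Longrightarrow> a \<otimes> c \<prec> b \<otimes> d"
  using less_trans[of "a \<otimes> c" "b \<otimes> c" "b \<otimes> d"]
  by (simp add: strict_def mult_right_le_iff mult_le_iff)

lemma pow_mono: "\<lbrakk>a \<preceq> b; a \<in> carrier G; b \<in> carrier G\<rbrakk> \<Longrightarrow> a [^] (n::nat) \<preceq> b [^] n"
  by (induction n) (auto intro: mult_mono le_refl)

lemma pow_strict_mono:
  assumes "a \<prec> b" "a \<in> carrier G" "b \<in> carrier G" "n > 0"
  shows "a [^] (n::nat) \<prec> b [^] n"
  using assms(4)
proof (induction n)
  case (Suc n)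
  then show ?case using assms(1-3) mult_strict_mono[of "a [^] n" "b [^] n" a b] by (cases n) auto
qed simp

text \<open>The induction peels off the outer factors:
  \<open>x (y x) ^ n y = (x y) ^ (n + 1)\<close>, while the inner word satisfies
  \<open>x ^ n y ^ n \<preceq> (x y) ^ n \<preceq> (y x) ^ n\<close>. The second bound is
  symmetric.\<close>

lemma pow_mult_le:
  assumes xy: "x \<otimes> y \<preceq> y \<otimes> x" and [simp]: "x \<in> carrier G" "y \<in> carrier G"
  shows "x [^] (n::nat) \<otimes> y [^] n \<preceq> (x \<otimes> y) [^] n" and "(y \<otimes> x) [^] n \<preceq> y [^] n \<otimes> x [^] n"
proof -
  have swap: "a \<otimes> ((b \<otimes> a) [^] n \<otimes> b) = (a \<otimes> b) [^] Suc n"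
    if [simp]: "a \<in> carrier G" "b \<in> carrier G" for a b and n :: nat
  proof (induction n)
    case (Suc n)
    have "a \<otimes> ((b \<otimes> a) [^] Suc n \<otimes> b) = (a \<otimes> ((b \<otimes> a) [^] n \<otimes> b)) \<otimes> (a \<otimes> b)"
      by (simp add: m_assoc)
    then show ?case using Suc by simp
  qed simp
  have le: "(x \<otimes> y) [^] n \<preceq> (y \<otimes> x) [^] n" for n :: nat using pow_mono xy by simp
  have "x [^] n \<otimes> y [^] n \<preceq> (x \<otimes> y) [^] n \<and> (y \<otimes> x) [^] n \<preceq> y [^] n \<otimes> x [^] n"
  proof (induction n)
    case (Suc n)
    have "x [^] Suc n \<otimes> y [^] Suc n = x \<otimes> ((x [^] n \<otimes> y [^] n) \<otimes> y)"
        "y [^] Suc n \<otimes> x [^] Suc n = y \<otimes> ((y [^] n \<otimes> x [^] n) \<otimes> x)"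
      using nat_pow_Suc2[of x n] nat_pow_Suc2[of y n] by (simp_all add: m_assoc)
    moreover have "x \<otimes> ((x [^] n \<otimes> y [^] n) \<otimes> y) \<preceq> x \<otimes> ((y \<otimes> x) [^] n \<otimes> y)"
      using Suc le[of n] le_trans[of "x [^] n \<otimes> y [^] n" "(x \<otimes> y) [^] n"]
      by (simp add: mult_le_iff mult_right_le_iff)
    moreover have "y \<otimes> ((x \<otimes> y) [^] n \<otimes> x) \<preceq> y \<otimes> ((y [^] n \<otimes> x [^] n) \<otimes> x)"
      using Suc le[of n] le_trans[of "(x \<otimes> y) [^] n" "(y \<otimes> x) [^] n"]
      by (simp add: mult_le_iff mult_right_le_iff)
    ultimately show ?case by (simp add: swap del: nat_pow_Suc)
  qed (simp add: le_refl)
  then show "x [^] n \<otimes> y [^] n \<preceq> (x \<otimes> y) [^] n" "(y \<otimes> x) [^] n \<preceq> y [^] n \<otimes> x [^] n" by auto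
qed

section \<open>Integer floors and the embedding into the reals\<close>

lemma int_pow_less_iff:
  assumes e: "e \<in> P"
  shows "e [^] (p::int) \<prec> e [^] q \<longleftrightarrow> p < q"
proof -
  have [simp]: "e \<in> carrier G" using e by (simp add: mem_P)
  have less: "e [^] p \<prec> e [^] q" if "p < q" for p q :: int
  proof -
    have "\<one> \<prec> e [^] (q - p)"
      using P_pow[OF e, of "nat (q - p)"] that by (simp add: mem_P pow_nat)
    then have "e [^] p \<otimes> \<one> \<prec> e [^] p \<otimes> e [^] (q - p)"
      by (simp only: mult_less_iff one_closed int_pow_closed \<open>e \<in> carrier G\<close>)
    then show ?thesis by (simp add: int_pow_mult[symmetric])
  qed
  show ?thesis using less[of p q] less[of q p] by (cases p q rule: linorder_cases) (auto simp: strict_def)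
qed

text \<open>The archimedean property bounds \<open>x\<close> above by a power of \<open>e\<close>;
  applied to \<open>inv x\<close> and followed by right translations it bounds \<open>x\<close>
  below. The last power not above \<open>x\<close> is the one sought.\<close>

lemma int_pow_floor:
  assumes e: "e \<in> P" and [simp]: "x \<in> carrier G"
  shows "\<exists>p::int. e [^] p \<preceq> x \<and> x \<prec> e [^] (p + 1)"
proof -
  have [simp]: "e \<in> carrier G" using e by (simp add: mem_P)
  obtain n :: nat where n: "x \<preceq> e [^] n" using archimedean[OF e, of x] by auto
  obtain m :: nat where "inv x \<preceq> e [^] m" using archimedean[OF e, of "inv x"] by auto
  then have "\<one> \<otimes> inv (e [^] m) \<preceq> x \<otimes> e [^] m \<otimes> inv (e [^] m)"
    by (simp only: mult_right_le_iff inv_le_iff one_closed nat_pow_closed m_closed inv_closed assms \<open>e \<in> carrier G\<close>)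
  then have m: "e [^] (- int m) \<preceq> x" by (simp add: m_assoc int_pow_neg_int)
  \<comment> \<open>Shifting exponents by the lower bound \<open>- m\<close> turns the search into
    one over natural numbers.\<close>
  define Q where "Q k \<longleftrightarrow> x \<prec> e [^] (int k - int m)" for k
  have "e [^] int n \<prec> e [^] (int n + 1)" using int_pow_less_iff[OF e] by simp
  then have "Q (n + m + 1)"
    using le_less_trans[OF n] by (simp add: Q_def int_pow_int add.commute)
  moreover have "\<not> Q 0" using m by (simp add: Q_def strict_def)
  ultimately obtain k where "\<not> Q k" "Q (Suc k)"
    using ex_least_nat_less[of Q "n + m + 1"] by auto
  then show ?thesis
    by (intro exI[of _ "int k - int m"]) (simp add: Q_def less_iff algebra_simps)
qed

text \<open>Raising the two bounds to the powers \<open>n\<close> and \<open>m\<close> encloses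
  \<open>x ^ (m n)\<close> between powers of \<open>e\<close>. This compares the approximations
  \<open>p / m\<close> and \<open>q / n\<close> of the value of \<open>x\<close>.\<close>

lemma int_pow_compare:
  assumes e: "e \<in> P" and [simp]: "x \<in> carrier G" and "m > 0" "n > 0"
    and le: "e [^] (p::int) \<preceq> x [^] (m::nat)" and less: "x [^] (n::nat) \<prec> e [^] (q::int)"
  shows "p * int n < q * int m"
proof -
  have [simp]: "e \<in> carrier G" using e by (simp add: mem_P)
  have pow: "(e [^] p) [^] n = e [^] (p * int n)" for p :: int and n :: nat
    using int_pow_pow[of e p "int n"] by (simp add: int_pow_int mult.commute)
  have "e [^] (p * int n) \<preceq> x [^] (m * n)"
    using pow_mono[OF le, of n] by (simp add: pow nat_pow_pow)
  moreover have "x [^] (m * n) \<prec> e [^] (q * int m)"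
    using pow_strict_mono[OF less, of m] \<open>m > 0\<close> by (simp add: pow nat_pow_pow mult.commute)
  ultimately have "e [^] (p * int n) \<prec> e [^] (q * int m)" by (rule le_less_trans) auto
  then show ?thesis using int_pow_less_iff[OF e] by simp
qed

lemma ex_P: "\<exists>e. e \<in> P"
proof -
  obtain g where g: "g \<in> carrier G" "g \<notin> C"
    using C_proper[OF is_group preorder] subgroup.subset[OF subgroup_C] by blast
  then have "\<one> \<prec> g \<or> g \<prec> \<one>" by (auto simp: mem_C less_iff)
  then have "g \<in> P \<or> inv g \<in> P"
    using g inv_mult_less_iff(2)[of g "\<one>" "\<one>"] by (auto simp: mem_P)
  then show ?thesis by blast
qed

text \<open>With \<open>f x\<close> the integer such that \<open>e ^ f x \<preceq> x \<prec> e ^ (f x + 1)\<close>, the embedding is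
  \<open>\<tau> x = (SUP n. f (x ^ n) / n)\<close>, and \<open>n * \<tau> x\<close> differs from \<open>f (x ^ n)\<close> by at most \<open>1\<close>. Since
  \<open>(x y) ^ n\<close> lies between \<open>x ^ n y ^ n\<close> and \<open>y ^ n x ^ n\<close>, additivity of \<open>\<tau>\<close> does not need that
  \<open>G/C\<close> is abelian, which is only a consequence.\<close>

theorem hoelder:
  "\<exists>\<tau>\<in>hom G real_group. \<forall>x\<in>carrier G. \<forall>y\<in>carrier G. x \<preceq> y \<longleftrightarrow> \<tau> x \<le> \<tau> y"
proof -
  obtain e where e: "e \<in> P" using ex_P by blast
  then have [simp]: "e \<in> carrier G" by (simp add: mem_P)
  obtain f where f: "\<And>x. x \<in> carrier G \<Longrightarrow> e [^] (f x :: int) \<preceq> x \<and> x \<prec> e [^] (f x + 1)"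
    using int_pow_floor[OF e] by metis
  have floor_le: "p \<le> f x" if "e [^] p \<preceq> x" "x \<in> carrier G" for p x
    using le_less_trans[OF that(1), of "e [^] (f x + 1)"] f[OF that(2)] that int_pow_less_iff[OF e]
    by simp
  have floor_ge: "f x < p" if "x \<prec> e [^] p" "x \<in> carrier G" for p x
    using le_less_trans[of "e [^] f x" x "e [^] p"] f[OF that(2)] that int_pow_less_iff[OF e] by simp
  define \<tau> where "\<tau> x = (SUP n\<in>{0<..}. real_of_int (f (x [^] n)) / real n)" for x
  \<comment> \<open>Every \<open>(f (x ^ n) + 1) / n\<close> bounds all the quotients in the
    supremum, so the supremum exists and is located within \<open>1 / n\<close>.\<close>
  have frac: "real_of_int (f (x [^] m)) / real m \<le> (real_of_int (f (x [^] n)) + 1) / real n"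
    if "x \<in> carrier G" "m > 0" "n > 0" for x and m n :: nat
  proof -
    have "f (x [^] m) * int n < (f (x [^] n) + 1) * int m"
      using int_pow_compare[OF e that(1-3)] f that by simp
    then have "real_of_int (f (x [^] m) * int n) < real_of_int ((f (x [^] n) + 1) * int m)"
      by (simp only: of_int_less_iff)
    then show ?thesis using that by (simp add: field_simps)
  qed
  have bounds: "real_of_int (f (x [^] n)) \<le> real n * \<tau> x" "real n * \<tau> x \<le> real_of_int (f (x [^] n)) + 1"
    if "x \<in> carrier G" "n > 0" for x and n :: nat
  proof -
    have "bdd_above ((\<lambda>n. real_of_int (f (x [^] n)) / real n) ` {0<..})"
      using frac[OF that(1) _ that(2)] by (auto intro!: bdd_aboveI2)
    then have "real_of_int (f (x [^] n)) / real n \<le> \<tau> x"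
      unfolding \<tau>_def using that by (intro cSUP_upper) auto
    moreover have "\<tau> x \<le> (real_of_int (f (x [^] n)) + 1) / real n"
      unfolding \<tau>_def using that frac by (intro cSUP_least) auto
    ultimately show "real_of_int (f (x [^] n)) \<le> real n * \<tau> x"
        "real n * \<tau> x \<le> real_of_int (f (x [^] n)) + 1"
      using that by (simp_all add: field_simps)
  qed
  have add: "\<tau> (x \<otimes> y) = \<tau> x + \<tau> y" if [simp]: "x \<in> carrier G" "y \<in> carrier G" for x y
  \<comment> \<open>Both \<open>n * \<tau> (x y)\<close> and
    \<open>n * (\<tau> x + \<tau> y)\<close> will lie between \<open>f a + f b\<close> and
    \<open>f a + f b + 2\<close>.\<close>
  proof (rule real_eq_if_multiples_close[where c = 2])
    fix n :: nat assume n: "n > 0"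
    define a b z where "a = x [^] n" and "b = y [^] n" and "z = (x \<otimes> y) [^] n"
    have [simp]: "a \<in> carrier G" "b \<in> carrier G" "z \<in> carrier G" by (auto simp: a_def b_def z_def)
    have "a \<otimes> b \<preceq> z \<and> z \<preceq> b \<otimes> a \<or> b \<otimes> a \<preceq> z \<and> z \<preceq> a \<otimes> b"
    proof (cases "x \<otimes> y \<preceq> y \<otimes> x")
      case True
      then show ?thesis
        using pow_mult_le[OF True, of n] pow_mono[OF True, of n]
          le_trans[of z "(y \<otimes> x) [^] n" "b \<otimes> a"] by (simp add: a_def b_def z_def)
    next
      case False
      then have yx: "y \<otimes> x \<preceq> x \<otimes> y" using le_total[of "x \<otimes> y" "y \<otimes> x"] by simp
      then show ?thesis
        using pow_mult_le[OF yx, of n] pow_mono[OF yx, of n]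
          le_trans[of "b \<otimes> a" "(y \<otimes> x) [^] n" z] by (simp add: a_def b_def z_def)
    qed
    \<comment> \<open>Renaming the factors merges the two cases; the floors enter only through their
      sum, which does not depend on the order of the factors.\<close>
    then obtain c d where cd: "{c, d} = {a, b}" and le: "c \<otimes> d \<preceq> z" "z \<preceq> d \<otimes> c" by blast
    have [simp]: "c \<in> carrier G" "d \<in> carrier G" using cd by (auto simp: doubleton_eq_iff)
    have sum: "f c + f d = f a + f b" using cd by (auto simp: doubleton_eq_iff)
    have "e [^] (f c + f d) \<preceq> c \<otimes> d" using f mult_mono by (simp add: int_pow_mult)
    then have "e [^] (f c + f d) \<preceq> z" using le le_trans[of _ "c \<otimes> d" z] by simp
    then have lower: "f a + f b \<le> f z" using floor_le[of "f c + f d" z] sum by simp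
    have "d \<otimes> c \<prec> e [^] (f d + 1) \<otimes> e [^] (f c + 1)" using f mult_strict_mono by simp
    also have "e [^] (f d + 1) \<otimes> e [^] (f c + 1) = e [^] (f d + 1 + (f c + 1))"
      by (rule int_pow_mult[symmetric]) simp
    finally have "z \<prec> e [^] (f d + 1 + (f c + 1))" using le le_less_trans[of z "d \<otimes> c"] by simp
    then have upper: "f z \<le> f a + f b + 1" using floor_ge[of z "f d + 1 + (f c + 1)"] sum by simp
    have "real_of_int (f a + f b) \<le> real_of_int (f z)" "real_of_int (f z) \<le> real_of_int (f a + f b + 1)"
      using lower upper by (simp_all only: of_int_le_iff)
    then show "\<bar>real n * \<tau> (x \<otimes> y) - real n * (\<tau> x + \<tau> y)\<bar> \<le> 2"
      using bounds[of x n] bounds[of y n] bounds[of "x \<otimes> y" n] n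
      by (simp add: a_def b_def z_def algebra_simps)
  qed
  have pos: "\<tau> x > 0" if x: "x \<in> P" for x
  proof -
    have [simp]: "x \<in> carrier G" using x by (simp add: mem_P)
    \<comment> \<open>A power of \<open>x\<close> reaching \<open>e\<close> has floor at least
      \<open>1\<close>; its exponent is not \<open>0\<close> because
      \<open>e \<preceq> \<one>\<close> is false.\<close>
    obtain n :: nat where n: "e \<preceq> x [^] n" using archimedean[OF x, of e] by auto
    have "n > 0" using n e by (cases n) (auto simp: mem_P strict_def)
    have "1 \<le> f (x [^] n)" using floor_le[of 1 "x [^] n"] n by simp
    then have "real n * \<tau> x > 0" using bounds(1)[of x n] \<open>n > 0\<close> by simp
    then show ?thesis using \<open>n > 0\<close> by (simp add: zero_less_mult_iff)
  qed
  have zero: "\<tau> x = 0" if "x \<in> C" for x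
  \<comment> \<open>All powers of \<open>x\<close> stay in \<open>C\<close> and have floor
    \<open>0\<close>, so \<open>n * \<tau> x\<close> stays between \<open>0\<close> and
    \<open>1\<close>.\<close>
  proof (rule real_eq_if_multiples_close[where c = 1])
    fix n :: nat assume n: "n > 0"
    have "x [^] n \<in> C"
      using that subgroup_C by (induction n) (auto simp: subgroup.one_closed subgroup.m_closed)
    then have xn: "x [^] n \<preceq> \<one>" "\<one> \<preceq> x [^] n" and [simp]: "x [^] n \<in> carrier G" "x \<in> carrier G"
      using that by (auto simp: mem_C)
    have "\<one> \<prec> e [^] (1::int)" using e by (simp add: mem_P)
    then have "f (x [^] n) < 1" using floor_ge[of "x [^] n" 1] le_less_trans[OF xn(1)] by simp
    moreover have "0 \<le> f (x [^] n)" using floor_le[of 0 "x [^] n"] xn by simp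
    ultimately have "f (x [^] n) = 0" by simp
    then show "\<bar>real n * \<tau> x - real n * 0\<bar> \<le> 1" using bounds[of x n] n by simp
  qed
  have order: "x \<preceq> y \<longleftrightarrow> \<tau> x \<le> \<tau> y" if [simp]: "x \<in> carrier G" "y \<in> carrier G" for x y
  proof (cases "x \<preceq> y")
    case True
    then have "inv x \<otimes> y \<in> P \<union> C" using lp_iff_cone[OF is_group preorder, of x y] by simp
    then have "0 \<le> \<tau> (inv x \<otimes> y)" using pos zero by force
    then show ?thesis using add[of x "inv x \<otimes> y"] True by (simp add: inv_cancel)
  next
    case False
    then have "inv y \<otimes> x \<in> P" using inv_mult_less_iff(2)[of y x "\<one>"] by (simp add: mem_P less_iff)
    then have "0 < \<tau> (inv y \<otimes> x)" by (rule pos)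
    then show ?thesis using add[of y "inv y \<otimes> x"] False by (simp add: inv_cancel)
  qed
  have "\<tau> \<in> hom G real_group" using add by (auto simp: hom_def real_group_def)
  then show ?thesis using order by blast
qed

end

section \<open>Convex jumps\<close>

context relative_left_preorder
begin

section \<open>The chain of convex subgroups and its jumps\<close>

lemma convex_subgroupD:
  assumes "convex_subgroup G (\<preceq>) H"
  shows "subgroup H G" and "\<lbrakk>x \<preceq> y; y \<preceq> z; x \<in> H; z \<in> H; y \<in> carrier G\<rbrakk> \<Longrightarrow> y \<in> H"
  using assms unfolding convex_subgroup_def by blast+

lemma ex_nonneg_not_mem:
  assumes "subgroup H G" "subgroup H' G" "x \<in> H" "x \<notin> H'"
  obtains y where "y \<in> H" "y \<notin> H'" "\<one> \<preceq> y"
proof -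
  have x: "x \<in> carrier G" by (rule subgroup.mem_carrier[OF assms(1,3)])
  have "\<one> \<preceq> x \<or> \<one> \<preceq> inv x"
    using le_total[of "\<one>" x] inv_le_iff(2)[of x "\<one>"] x by auto
  moreover have "inv x \<in> H" by (rule subgroup.m_inv_closed[OF assms(1,3)])
  moreover have "inv x \<notin> H'" using assms(4) subgroup.m_inv_closed[OF assms(2), of "inv x"] x by auto
  ultimately show thesis using that assms(3,4) by blast
qed

text \<open>Otherwise each subgroup has a nonnegative element outside the other. The smaller of the
  two lies between \<open>\<one>\<close> and the larger, hence in the subgroup of the
  larger.\<close>

lemma convex_subgroups_chain:
  assumes H: "convex_subgroup G (\<preceq>) H" and H': "convex_subgroup G (\<preceq>) H'"
  shows "H \<subseteq> H' \<or> H' \<subseteq> H"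
proof (rule ccontr)
  note sub = convex_subgroupD(1)[OF H] convex_subgroupD(1)[OF H']
  assume n: "\<not> (H \<subseteq> H' \<or> H' \<subseteq> H)"
  obtain x where "x \<in> H" "x \<notin> H'" "\<one> \<preceq> x"
    using n ex_nonneg_not_mem[OF sub] by blast
  moreover obtain y where "y \<in> H'" "y \<notin> H" "\<one> \<preceq> y"
    using n ex_nonneg_not_mem[OF sub(2,1)] by blast
  ultimately show False
    using convex_subgroupD(2)[OF H, of "\<one>" y x] convex_subgroupD(2)[OF H', of "\<one>" x y]
      le_total[of x y] subgroup.one_closed[OF sub(1)] subgroup.one_closed[OF sub(2)]
      subgroup.mem_carrier[OF sub(1), of x] subgroup.mem_carrier[OF sub(2), of y] by blast
qed

lemma convex_subgroup_carrier: "convex_subgroup G (\<preceq>) (carrier G)"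
  by (simp add: convex_subgroup_def subgroup_self)

lemma convex_subgroup_C: "convex_subgroup G (\<preceq>) C"
  unfolding convex_subgroup_def
proof (intro conjI ballI impI)
  fix x z y assume *: "x \<in> C" "z \<in> C" "y \<in> carrier G" "x \<preceq> y \<and> y \<preceq> z"
  then show "y \<in> C"
    using le_trans[of "\<one>" x y] le_trans[of y z "\<one>"] by (simp add: mem_C)
qed (rule subgroup_C)

lemma convex_subgroup_Inter:
  assumes "\<H> \<noteq> {}" and conv: "\<And>H. H \<in> \<H> \<Longrightarrow> convex_subgroup G (\<preceq>) H"
  shows "convex_subgroup G (\<preceq>) (\<Inter>\<H>)"
  unfolding convex_subgroup_def
proof (intro conjI ballI impI)
  show "subgroup (\<Inter>\<H>) G"
    using subgroups_Inter assms(1) convex_subgroupD(1)[OF conv] by blast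
  fix x z y assume *: "x \<in> \<Inter>\<H>" "z \<in> \<Inter>\<H>" "y \<in> carrier G" "x \<preceq> y \<and> y \<preceq> z"
  show "y \<in> \<Inter>\<H>"
  proof
    fix H assume "H \<in> \<H>"
    then show "y \<in> H" using * convex_subgroupD(2)[OF conv, of H x y z] by simp
  qed
qed

text \<open>Since convex subgroups form a chain, any two elements of the union lie in a common
  member.\<close>

lemma convex_subgroup_Union:
  assumes "\<H> \<noteq> {}" and conv: "\<And>H. H \<in> \<H> \<Longrightarrow> convex_subgroup G (\<preceq>) H"
  shows "convex_subgroup G (\<preceq>) (\<Union>\<H>)"
proof -
  have sub: "subgroup H G" if "H \<in> \<H>" for H
    using convex_subgroupD(1)[OF conv[OF that]] .
  have common: "\<exists>H\<in>\<H>. x \<in> H \<and> y \<in> H" if xy: "x \<in> \<Union>\<H>" "y \<in> \<Union>\<H>" for x y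
  proof -
    obtain H where H: "x \<in> H" "H \<in> \<H>" using xy(1) by (rule UnionE)
    obtain H' where H': "y \<in> H'" "H' \<in> \<H>" using xy(2) by (rule UnionE)
    show ?thesis
      using convex_subgroups_chain[OF conv[OF H(2)] conv[OF H'(2)]] H H' by (meson subsetD)
  qed
  show ?thesis
    unfolding convex_subgroup_def
  proof (intro conjI subgroupI ballI impI)
    show "\<Union>\<H> \<subseteq> carrier G" using sub by (intro Union_least subgroup.subset)
    obtain H where "H \<in> \<H>" using assms(1) by blast
    then show "\<Union>\<H> \<noteq> {}" using subgroup.one_closed[OF sub[of H]] by blast
  next
    fix x assume "x \<in> \<Union>\<H>"
    then obtain H where H: "H \<in> \<H>" "x \<in> H" by blast
    then show "inv x \<in> \<Union>\<H>" using subgroup.m_inv_closed[OF sub[OF H(1)] H(2)] by blast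
  next
    fix x y assume "x \<in> \<Union>\<H>" "y \<in> \<Union>\<H>"
    then obtain H where H: "H \<in> \<H>" "x \<in> H" "y \<in> H" using common by blast
    then show "x \<otimes> y \<in> \<Union>\<H>" using subgroup.m_closed[OF sub[OF H(1)] H(2,3)] by blast
  next
    fix x z y assume xz: "x \<in> \<Union>\<H>" "z \<in> \<Union>\<H>" and y: "y \<in> carrier G" "x \<preceq> y \<and> y \<preceq> z"
    obtain H where H: "H \<in> \<H>" "x \<in> H" "z \<in> H" using xz common by blast
    then show "y \<in> \<Union>\<H>" using convex_subgroupD(2)[OF conv[OF H(1)], of x y z] y by blast
  qed
qed

text \<open>Take for \<open>K\<close> the largest convex subgroup avoiding \<open>c\<close> and for
  \<open>L\<close> the smallest one containing \<open>c\<close>. Any convex subgroup either avoids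
  \<open>c\<close> and lies in \<open>K\<close>, or contains \<open>c\<close> and includes
  \<open>L\<close>.\<close>

lemma ex_convex_jump:
  assumes c: "c \<in> P"
  shows "\<exists>K L. convex_jump G (\<preceq>) K L \<and> c \<in> L \<and> c \<notin> K"
proof -
  define K where "K = \<Union>{H. convex_subgroup G (\<preceq>) H \<and> c \<notin> H}"
  define L where "L = \<Inter>{H. convex_subgroup G (\<preceq>) H \<and> c \<in> H}"
  have "c \<in> carrier G" "c \<notin> C" using c by (auto simp: mem_P mem_C strict_def)
  then have "C \<in> {H. convex_subgroup G (\<preceq>) H \<and> c \<notin> H}"
      "carrier G \<in> {H. convex_subgroup G (\<preceq>) H \<and> c \<in> H}"
    using convex_subgroup_carrier convex_subgroup_C by simp_all
  then have KL: "convex_subgroup G (\<preceq>) K" "convex_subgroup G (\<preceq>) L"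
    unfolding K_def L_def by (intro convex_subgroup_Union convex_subgroup_Inter; blast)+
  moreover have "c \<notin> K" "c \<in> L" by (auto simp: K_def L_def)
  moreover have "K \<subset> L" using convex_subgroups_chain[OF KL] calculation by blast
  moreover have "\<not> (\<exists>H. convex_subgroup G (\<preceq>) H \<and> K \<subset> H \<and> H \<subset> L)"
    unfolding K_def L_def by blast
  ultimately show ?thesis unfolding convex_jump_def by blast
qed

text \<open>In the jump of the larger element \<open>c\<close>, both \<open>a\<close> and
  \<open>b\<close> lie in \<open>L\<close> and have nonnegative images, and that of \<open>c\<close>
  is positive. Hence \<open>\<tau> a + \<tau> b > 0\<close>, which says
  \<open>\<tau> (b a ^ 2) > \<tau> a\<close>.\<close>

lemma real_embeddings_imp_square_property:
  assumes emb: "\<And>K L. convex_jump G (\<preceq>) K L \<Longrightarrow>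
      \<exists>\<tau>\<in>hom (G\<lparr>carrier := L\<rparr>) real_group.
        \<forall>x\<in>L. \<forall>y\<in>L. induced_preorder G (\<preceq>) K L x y \<longleftrightarrow> \<tau> x \<le> \<tau> y"
  shows square_property
  unfolding square_property_def
proof (intro ballI)
  fix a b assume ab: "a \<in> P" "b \<in> P"
  then have [simp]: "a \<in> carrier G" "b \<in> carrier G" and pos: "\<one> \<preceq> a" "\<one> \<preceq> b"
    by (auto simp: mem_P strict_def)
  obtain c where c: "c \<in> P" "a \<preceq> c" "b \<preceq> c" "c = a \<or> c = b"
    using ab le_total[of a b] le_refl by auto
  obtain K L where jump: "convex_jump G (\<preceq>) K L" and cKL: "c \<in> L" "c \<notin> K"
    using ex_convex_jump[OF c(1)] by blast
  then have conv: "convex_subgroup G (\<preceq>) K" "convex_subgroup G (\<preceq>) L" "K \<subseteq> L"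
    by (auto simp: convex_jump_def)
  note subL = convex_subgroupD(1)[OF conv(2)] and subK = convex_subgroupD(1)[OF conv(1)]
  have one: "\<one> \<in> L" using subL by (rule subgroup.one_closed)
  have abL: "a \<in> L" "b \<in> L" using convex_subgroupD(2)[OF conv(2) _ _ one cKL(1)] pos c by auto
  obtain \<tau> where \<tau>: "\<tau> \<in> hom (G\<lparr>carrier := L\<rparr>) real_group"
    and order: "\<And>x y. \<lbrakk>x \<in> L; y \<in> L\<rbrakk> \<Longrightarrow> induced_preorder G (\<preceq>) K L x y \<longleftrightarrow> \<tau> x \<le> \<tau> y"
    using emb[OF jump] by blast
  have add: "\<tau> (x \<otimes> y) = \<tau> x + \<tau> y" if "x \<in> L" "y \<in> L" for x y
    using \<tau> that by (simp add: hom_def real_group_def)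
  have \<tau>_one: "\<tau> \<one> = 0" using add[of "\<one>" "\<one>"] one by simp
  note ind = induced_preorder_iff[OF is_group preorder conv]
  have "0 \<le> \<tau> a" "0 \<le> \<tau> b" using order[OF one] ind[OF one] pos abL \<tau>_one by auto
  moreover have "\<not> induced_preorder G (\<preceq>) K L c \<one>"
    using c cKL one subgroup.m_inv_closed[OF subK, of "inv c"]
    by (auto simp: ind mem_P strict_def)
  then have "0 < \<tau> c" using order[of c "\<one>"] \<tau>_one cKL one by simp
  ultimately have "0 < \<tau> a + \<tau> b" using c(4) by auto
  moreover have "b \<otimes> a [^] (2::nat) \<in> L" "\<tau> (b \<otimes> a [^] (2::nat)) = \<tau> b + (\<tau> a + \<tau> a)"
    using abL subgroup.m_closed[OF subL] add by (simp_all add: numeral_2_eq_2)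
  \<comment> \<open>On \<open>L\<close> the induced preorder contains the original one, so its
    failure rules out \<open>b a ^ 2 \<preceq> a\<close> as well.\<close>
  ultimately have "\<not> induced_preorder G (\<preceq>) K L (b \<otimes> a [^] (2::nat)) a" using order abL by simp
  then show "a \<prec> b \<otimes> a [^] (2::nat)"
    using ind[of "b \<otimes> a [^] (2::nat)" a] abL \<open>b \<otimes> a [^] (2::nat) \<in> L\<close> by (simp add: less_iff)
qed

section \<open>The convex subgroup spanned by a positive element\<close>

text \<open>Only an upper bound is imposed; the subgroup is obtained later by asking it of both
  \<open>x\<close> and \<open>inv x\<close>.\<close>

definition dominated where
  "dominated a = {x \<in> carrier G. \<exists>n::nat. x \<preceq> a [^] n}"

lemma square_propertyD:
  assumes square_property "a \<in> P" "b \<in> P" "n > 0"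
  shows "a [^] (n::nat) \<prec> b \<otimes> a [^] (2 * n)"
proof -
  have "a \<in> carrier G" using assms by (simp add: mem_P)
  moreover have "a [^] n \<prec> b \<otimes> (a [^] n) [^] (2::nat)"
    using assms P_pow[of a n] unfolding square_property_def by blast
  ultimately show ?thesis by (simp add: nat_pow_pow mult.commute)
qed

text \<open>With \<open>x\<close> and \<open>y\<close> strictly below \<open>a ^ k\<close>, the
  element \<open>inv x a ^ k\<close> is positive. The square property for it and
  \<open>a ^ k\<close> gives \<open>x a ^ k \<prec> a ^ (3 k)\<close>, and
  \<open>x y \<prec> x a ^ k\<close> by left invariance.\<close>

lemma dominated_mult:
  assumes sq: square_property and a: "a \<in> P" and x: "x \<in> dominated a" and y: "y \<in> dominated a"
  shows "x \<otimes> y \<in> dominated a"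
proof (rule ccontr)
  assume n: "x \<otimes> y \<notin> dominated a"
  have [simp]: "a \<in> carrier G" "x \<in> carrier G" "y \<in> carrier G"
    using a x y by (auto simp: mem_P dominated_def)
  have big: "a [^] m \<prec> x \<otimes> y" for m :: nat using n by (auto simp: dominated_def less_iff)
  obtain i j :: nat where "x \<preceq> a [^] i" "y \<preceq> a [^] j" using x y by (auto simp: dominated_def)
  define k where "k = Suc (max i j)"
  have "x \<prec> a [^] k" "y \<prec> a [^] k"
    using pow_strict_mono_exp[OF a, of i k] pow_strict_mono_exp[OF a, of j k]
      le_less_trans[of x "a [^] i"] le_less_trans[of y "a [^] j"] \<open>x \<preceq> a [^] i\<close> \<open>y \<preceq> a [^] j\<close>
    by (auto simp: k_def less_Suc_eq_le)
  then have "inv x \<otimes> a [^] k \<in> P" by (simp add: mem_P inv_mult_less_iff)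
  then have "a [^] k \<prec> (inv x \<otimes> a [^] k) \<otimes> a [^] (2 * k)"
    using sq a by (intro square_propertyD) (auto simp: k_def)
  also have "(inv x \<otimes> a [^] k) \<otimes> a [^] (2 * k) = inv x \<otimes> a [^] (3 * k)"
    by (simp add: m_assoc nat_pow_mult)
  finally have "x \<otimes> a [^] k \<prec> a [^] (3 * k)" by (simp add: inv_mult_less_iff)
  moreover have "x \<otimes> y \<prec> x \<otimes> a [^] k" using \<open>y \<prec> a [^] k\<close> by (simp add: mult_less_iff)
  ultimately have "x \<otimes> y \<prec> a [^] (3 * k)" using less_trans[of "x \<otimes> y" "x \<otimes> a [^] k"] by simp
  then show False using big[of "3 * k"] by (simp add: strict_def)
qed

text \<open>Inversion need not reverse a left-preorder, so an upper bound of \<open>inv x\<close> is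
  not directly a lower bound of \<open>x\<close>. In both directions the square property converts
  one into the other, replacing the exponent \<open>n\<close> by \<open>2 (n + 1)\<close>.\<close>

lemma inv_dominated_iff:
  assumes sq: square_property and a: "a \<in> P" and [simp]: "x \<in> carrier G"
  shows "inv x \<in> dominated a \<longleftrightarrow> (\<exists>n::nat. inv (a [^] n) \<preceq> x)"
proof
  have [simp]: "a \<in> carrier G" using a by (simp add: mem_P)
  assume "inv x \<in> dominated a"
  then obtain n :: nat where n: "inv x \<preceq> a [^] n" by (auto simp: dominated_def)
  show "\<exists>n::nat. inv (a [^] n) \<preceq> x"
  proof (rule ccontr)
    assume "\<not> ?thesis"
    then have "inv (a [^] (2 * Suc n) \<otimes> x) \<in> P"
      using inv_mult_less_iff(2)[of "a [^] (2 * Suc n) \<otimes> x" "\<one>" "\<one>"]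
      by (simp add: inv_le_iff less_iff mem_P del: mult_Suc_right)
    then have "a [^] Suc n \<prec> inv (a [^] (2 * Suc n) \<otimes> x) \<otimes> a [^] (2 * Suc n)"
      using sq a by (intro square_propertyD) auto
    also have "inv (a [^] (2 * Suc n) \<otimes> x) \<otimes> a [^] (2 * Suc n) = inv x"
      by (simp add: inv_mult_group m_assoc del: mult_Suc_right)
    finally have "a [^] Suc n \<prec> a [^] n" using less_le_trans[OF _ n] by simp
    moreover have "a [^] n \<prec> a [^] Suc n" using a by (intro pow_strict_mono_exp) auto
    ultimately show False by (simp add: strict_def)
  qed
next
  have [simp]: "a \<in> carrier G" using a by (simp add: mem_P)
  assume "\<exists>n::nat. inv (a [^] n) \<preceq> x"
  then obtain n :: nat where n: "\<one> \<preceq> a [^] n \<otimes> x" by (auto simp: inv_le_iff)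
  have "\<one> \<prec> a" using a by (simp add: mem_P)
  \<comment> \<open>The additional factor \<open>a\<close> turns the weak bound
    \<open>\<one> \<preceq> a ^ n x\<close> into membership in \<open>P\<close>.\<close>
  moreover have "a \<preceq> a [^] Suc n \<otimes> x"
    using n mult_le_iff[of "\<one>" "a [^] n \<otimes> x" a] nat_pow_Suc2[of a n] by (simp add: m_assoc)
  ultimately have "a [^] Suc n \<otimes> x \<in> P" using less_le_trans[of "\<one>" a] by (simp add: mem_P)
  then have "a [^] Suc n \<prec> a [^] Suc n \<otimes> x \<otimes> a [^] (2 * Suc n)"
    using sq a by (intro square_propertyD) auto
  then have "\<one> \<prec> x \<otimes> a [^] (2 * Suc n)"
    using mult_less_iff[of "\<one>" "x \<otimes> a [^] (2 * Suc n)" "a [^] Suc n"]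
    by (simp add: m_assoc del: mult_Suc_right nat_pow_Suc)
  then have "inv x \<preceq> a [^] (2 * Suc n)" by (simp add: inv_le_iff strict_def del: mult_Suc_right)
  then show "inv x \<in> dominated a" unfolding dominated_def using assms(3) by blast
qed

text \<open>For convexity, an upper bound passes from \<open>z\<close> down to \<open>y\<close>, and
  a lower bound from \<open>x\<close> up to \<open>y\<close>; \<open>inv_dominated_iff\<close>
  translates the latter into the condition on inverses.\<close>

lemma convex_hull_is_subgroup:
  assumes sq: square_property and a: "a \<in> P"
  shows "convex_subgroup G (\<preceq>) {x \<in> dominated a. inv x \<in> dominated a}" (is "convex_subgroup _ _ ?H")
proof -
  have [simp]: "a \<in> carrier G" using a by (simp add: mem_P)
  have carr: "x \<in> carrier G" if "x \<in> dominated a" for x using that by (simp add: dominated_def)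
  have "\<one> \<in> dominated a" using le_refl[of "\<one>"] by (auto simp: dominated_def intro!: exI[of _ 0])
  show ?thesis
    unfolding convex_subgroup_def
  proof (intro conjI subgroupI ballI impI)
    show "?H \<noteq> {}" using \<open>\<one> \<in> dominated a\<close> by (auto intro: exI[of _ "\<one>"])
    show "x \<otimes> y \<in> ?H" if "x \<in> ?H" "y \<in> ?H" for x y
      using that carr dominated_mult[OF sq a] by (auto simp: inv_mult_group)
    show "y \<in> ?H" if xz: "x \<in> ?H" "z \<in> ?H" and [simp]: "y \<in> carrier G" and le: "x \<preceq> y \<and> y \<preceq> z"
      for x y z
    proof -
      have [simp]: "x \<in> carrier G" "z \<in> carrier G" using xz carr by auto
      obtain n :: nat where "z \<preceq> a [^] n" using xz by (auto simp: dominated_def)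
      then have "y \<preceq> a [^] n" using le le_trans[of y z "a [^] n"] by simp
      then have "y \<in> dominated a" by (auto simp: dominated_def)
      moreover obtain m :: nat where "inv (a [^] m) \<preceq> x"
        using xz inv_dominated_iff[OF sq a, of x] by auto
      then have "inv (a [^] m) \<preceq> y" using le le_trans[of "inv (a [^] m)" x y] by simp
      then have "inv y \<in> dominated a" using inv_dominated_iff[OF sq a, of y] by auto
      ultimately show ?thesis by simp
    qed
  qed (auto simp: carr)
qed

section \<open>Convex jumps under the square property\<close>

text \<open>The convex subgroup spanned by \<open>a\<close> lies in \<open>L\<close> and, containing
  \<open>a\<close>, strictly includes \<open>K\<close>. As nothing lies strictly inside the jump, it
  equals \<open>L\<close>.\<close>

lemma convex_jump_archimedean:
  assumes sq: square_property and jump: "convex_jump G (\<preceq>) K L"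
    and a: "a \<in> P" "a \<in> L" "a \<notin> K" and b: "b \<in> L"
  shows "\<exists>n::nat. b \<preceq> a [^] n"
proof -
  let ?H = "{x \<in> dominated a. inv x \<in> dominated a}"
  have K: "convex_subgroup G (\<preceq>) K" and L: "convex_subgroup G (\<preceq>) L"
    using jump by (auto simp: convex_jump_def)
  note H = convex_hull_is_subgroup[OF sq a(1)] and subL = convex_subgroupD(1)[OF L]
  have [simp]: "a \<in> carrier G" using a by (simp add: mem_P)
  have pow: "a [^] n \<in> L" for n :: nat
    using a subgroup.one_closed[OF subL] subgroup.m_closed[OF subL] by (induction n) auto
  have "inv a \<preceq> \<one>" using a by (simp add: inv_le_iff mem_P strict_def)
  then have "a \<in> ?H"
    using le_refl[of a] by (auto simp: dominated_def intro: exI[of _ "0::nat"] exI[of _ "1::nat"])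
  then have "K \<subset> ?H" using convex_subgroups_chain[OF H K] a by blast
  moreover have "?H \<subseteq> L"
  proof
    fix x assume x: "x \<in> ?H"
    then have [simp]: "x \<in> carrier G" by (simp add: dominated_def)
    obtain m n :: nat where "x \<preceq> a [^] m" "inv (a [^] n) \<preceq> x"
      using x inv_dominated_iff[OF sq a(1), of x] by (auto simp: dominated_def)
    then show "x \<in> L"
      using convex_subgroupD(2)[OF L, of "inv (a [^] n)" x "a [^] m"] pow
        subgroup.m_inv_closed[OF subL pow] by simp
  qed
  ultimately have "?H = L" using jump H unfolding convex_jump_def by blast
  then show ?thesis using b by (auto simp: dominated_def)
qed

text \<open>It suffices to exclude conjugates in \<open>P - K\<close>: for one outside both
  \<open>P\<close> and \<open>K\<close>, the inverse is a conjugate of \<open>inv k\<close> in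
  \<open>P - K\<close>. The powers \<open>inv h k ^ n h\<close> of such a conjugate would surpass
  every element of \<open>L\<close>; suitable elements built from \<open>h\<close> refute
  this.\<close>

lemma convex_jump_conj_closed:
  assumes sq: square_property and jump: "convex_jump G (\<preceq>) K L" and k: "k \<in> K" and h: "h \<in> L"
  shows "inv h \<otimes> k \<otimes> h \<in> K"
proof (rule ccontr)
  have K: "convex_subgroup G (\<preceq>) K" and L: "convex_subgroup G (\<preceq>) L" and "K \<subseteq> L"
    using jump by (auto simp: convex_jump_def)
  note subK = convex_subgroupD(1)[OF K] and subL = convex_subgroupD(1)[OF L]
  have one: "\<one> \<in> K" using subK by (rule subgroup.one_closed)
  have CK: "C \<subseteq> K" using K by (rule C_subset_convex)
  have [simp]: "h \<in> carrier G" by (rule subgroup.mem_carrier[OF subL h])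
  have not_P: "inv h \<otimes> k \<otimes> h \<notin> P" if k: "k \<in> K" and nK: "inv h \<otimes> k \<otimes> h \<notin> K" for k
  proof
    define y where "y = inv h \<otimes> k \<otimes> h"
    assume "inv h \<otimes> k \<otimes> h \<in> P"
    then have y: "y \<in> P" "y \<in> L" "y \<notin> K"
      using nK k h \<open>K \<subseteq> L\<close> subgroup.m_closed[OF subL] subgroup.m_inv_closed[OF subL h]
      by (auto simp: y_def)
    have [simp]: "k \<in> carrier G" by (rule subgroup.mem_carrier[OF subK k])
    have hK: "h \<notin> K"
      using y(3) k subgroup.m_closed[OF subK] subgroup.m_inv_closed[OF subK] by (auto simp: y_def)
    have pow: "k [^] n \<in> K" for n :: nat
      using k subgroup.one_closed[OF subK] subgroup.m_closed[OF subK] by (induction n) auto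
    have y_pow: "y [^] n = inv h \<otimes> (k [^] n \<otimes> h)" for n :: nat
      using conj_nat_pow[of k h n] by (simp add: y_def m_assoc)
    show False
    proof (cases "\<one> \<preceq> h")
      case True
      \<comment> \<open>Surpassing \<open>h h\<close> means
        \<open>k ^ (-n) h h ^ 2 \<preceq> h\<close>. As \<open>h\<close> lies above all of
        \<open>K\<close>, \<open>k ^ (-n) h\<close> is positive and the square property is
        violated.\<close>
      obtain n :: nat where "h \<otimes> h \<preceq> y [^] n"
        using convex_jump_archimedean[OF sq jump y subgroup.m_closed[OF subL h h]] by blast
      then have le: "inv (k [^] n) \<otimes> h \<otimes> h [^] (2::nat) \<preceq> h"
        by (simp add: y_pow inv_mult_le_iff m_assoc numeral_2_eq_2)
      have "\<not> h \<preceq> k [^] n"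
        using convex_subgroupD(2)[OF K True _ one pow] hK by auto
      then have "inv (k [^] n) \<otimes> h \<in> P" by (simp add: mem_P inv_mult_le_iff less_iff)
      moreover have "h \<notin> C" using hK CK by blast
      then have "h \<in> P" using True by (simp add: mem_P mem_C strict_def)
      ultimately have "h \<prec> inv (k [^] n) \<otimes> h \<otimes> h [^] (2::nat)"
        using sq by (simp add: square_property_def)
      with le show False by (simp add: strict_def)
    next
      case False
      then have "h \<preceq> \<one>" using le_total[of h "\<one>"] by simp
      \<comment> \<open>Surpassing \<open>inv h\<close> means
        \<open>k ^ (-n) \<preceq> h \<preceq> \<one>\<close>, so convexity would put
        \<open>h\<close> into \<open>K\<close>.\<close>
      obtain n :: nat where "inv h \<preceq> y [^] n"
        using convex_jump_archimedean[OF sq jump y subgroup.m_inv_closed[OF subL h]] by blast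
      then have "inv (k [^] n) \<preceq> h"
        by (simp add: y_pow inv_mult_le_iff inv_cancel inv_le_iff)
      then show False
        using convex_subgroupD(2)[OF K _ \<open>h \<preceq> \<one>\<close> subgroup.m_inv_closed[OF subK pow] one] hK by simp
    qed
  qed
  assume nK: "inv h \<otimes> k \<otimes> h \<notin> K"
  have [simp]: "k \<in> carrier G" by (rule subgroup.mem_carrier[OF subK k])
  have inv: "inv (inv h \<otimes> k \<otimes> h) = inv h \<otimes> inv k \<otimes> h" by (simp add: inv_mult_group m_assoc)
  have "inv (inv h \<otimes> k \<otimes> h) \<notin> K"
    using nK subgroup.m_inv_closed[OF subK, of "inv (inv h \<otimes> k \<otimes> h)"] by auto
  then have "inv (inv h \<otimes> k \<otimes> h) \<notin> P"
    using not_P[OF subgroup.m_inv_closed[OF subK k]] unfolding inv by blast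
  then have "\<one> \<preceq> inv h \<otimes> k \<otimes> h"
    using inv_mult_less_iff(2)[of "inv h \<otimes> k \<otimes> h" "\<one>" "\<one>"] by (simp add: mem_P less_iff)
  moreover have "inv h \<otimes> k \<otimes> h \<notin> C" using nK CK by blast
  ultimately show False using not_P[OF k nK] by (simp add: mem_P mem_C strict_def)
qed

text \<open>Closure under conjugation gives normality. Together with the archimedean property of the
  jump it makes \<open>hoelder\<close> available inside \<open>L\<close>, relative to
  \<open>K\<close>.\<close>

lemma convex_jump_normal_hoelder:
  assumes sq: square_property and jump: "convex_jump G (\<preceq>) K L"
  shows "K \<lhd> G\<lparr>carrier := L\<rparr>"
    and "\<exists>\<tau>\<in>hom (G\<lparr>carrier := L\<rparr>) real_group.
      \<forall>x\<in>L. \<forall>y\<in>L. induced_preorder G (\<preceq>) K L x y \<longleftrightarrow> \<tau> x \<le> \<tau> y"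
proof -
  let ?L = "G\<lparr>carrier := L\<rparr>"
  have K: "convex_subgroup G (\<preceq>) K" and L: "convex_subgroup G (\<preceq>) L" and KL: "K \<subset> L"
    using jump by (auto simp: convex_jump_def)
  note subK = convex_subgroupD(1)[OF K] and subL = convex_subgroupD(1)[OF L]
  interpret L: group ?L using subL by (rule subgroup.subgroup_is_group) (rule is_group)
  show normal: "K \<lhd> ?L"
  proof (rule L.normal_invI)
    show "subgroup K ?L" using subgroup_incl[OF subK subL] KL by blast
    fix h k assume "h \<in> carrier ?L" "k \<in> K"
    then show "h \<otimes>\<^bsub>?L\<^esub> k \<otimes>\<^bsub>?L\<^esub> inv\<^bsub>?L\<^esub> h \<in> K"
      using convex_jump_conj_closed[OF sq jump, of k "inv h"] subgroup.m_inv_closed[OF subL, of h]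
        subgroup.mem_carrier[OF subL, of h] subL by simp
  qed
  note ind = induced_preorder_left_preorder[OF is_group preorder K L KL]
  interpret L: archimedean_left_preorder ?L K "induced_preorder G (\<preceq>) K L"
  proof (intro archimedean_left_preorder.intro relative_left_preorder.intro
      relative_left_preorder_axioms.intro archimedean_left_preorder_axioms.intro)
    show "group ?L" by (rule L.is_group)
    show "left_preorder_rel ?L K (induced_preorder G (\<preceq>) K L)" by (rule ind)
    show "K \<lhd> ?L" by (rule normal)
    fix a b assume a: "a \<in> positive_cone ?L (induced_preorder G (\<preceq>) K L)" and "b \<in> carrier ?L"
    then obtain n :: nat where "b \<preceq> a [^] n"
      using convex_jump_archimedean[OF sq jump, of a b] ind by auto
    moreover have "a [^] n \<in> L"
      using a ind(2) subgroup.one_closed[OF subL] subgroup.m_closed[OF subL] by (induction n) auto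
    ultimately have "induced_preorder G (\<preceq>) K L b (a [^] n)"
      using induced_preorder_iff[OF is_group preorder K L] KL \<open>b \<in> carrier ?L\<close> by auto
    then show "\<exists>n::nat. induced_preorder G (\<preceq>) K L b (a [^]\<^bsub>?L\<^esub> n)"
      by (auto simp: nat_pow_consistent[symmetric])
  qed
  show "\<exists>\<tau>\<in>hom ?L real_group. \<forall>x\<in>L. \<forall>y\<in>L. induced_preorder G (\<preceq>) K L x y \<longleftrightarrow> \<tau> x \<le> \<tau> y"
    using L.hoelder by simp
qed

section \<open>Embeddings of the quotient as homomorphisms on the group\<close>

text \<open>One direction composes with the projection. Conversely, a homomorphism reflecting the
  preorder vanishes exactly on \<open>C\<close>, so it factors injectively through the
  quotient.\<close>

lemma mon_quotient_iff_hom: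
  assumes "C \<lhd> G"
  shows "(\<exists>\<tau>\<in>mon (G Mod C) real_group. \<forall>x\<in>carrier G. \<forall>y\<in>carrier G.
        coset_le (\<preceq>) (x <# C) (y <# C) \<longleftrightarrow> \<tau> (x <# C) \<le> \<tau> (y <# C))
    \<longleftrightarrow> (\<exists>\<sigma>\<in>hom G real_group. \<forall>x\<in>carrier G. \<forall>y\<in>carrier G. x \<preceq> y \<longleftrightarrow> \<sigma> x \<le> \<sigma> y)"
    (is "?mon \<longleftrightarrow> ?hom")
proof
  interpret normal C G by (rule assms)
  note coset_le_iff = coset_le_iff[OF is_group preorder]
  {
    assume ?mon
    then obtain \<tau> where \<tau>: "\<tau> \<in> mon (G Mod C) real_group"
      and order: "\<And>x y. \<lbrakk>x \<in> carrier G; y \<in> carrier G\<rbrakk> \<Longrightarrow>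
        coset_le (\<preceq>) (x <# C) (y <# C) \<longleftrightarrow> \<tau> (x <# C) \<le> \<tau> (y <# C)" by blast
    \<comment> \<open>\<open>G Mod C\<close> consists of right cosets while the order is stated for
      left cosets; normality identifies them.\<close>
    define \<sigma> where "\<sigma> = compose (carrier G) \<tau> ((#>) C)"
    have "\<tau> \<in> hom (G Mod C) real_group" using \<tau> unfolding mon_def by blast
    then have \<sigma>: "\<sigma> \<in> hom G real_group"
      unfolding \<sigma>_def by (rule hom_compose[OF r_coset_hom_Mod])
    have \<sigma>_eq: "\<sigma> x = \<tau> (x <# C)" if "x \<in> carrier G" for x
      using that bspec[OF coset_eq that] by (simp only: \<sigma>_def compose_eq)
    have "x \<preceq> y \<longleftrightarrow> \<sigma> x \<le> \<sigma> y" if xy: "x \<in> carrier G" "y \<in> carrier G" for x y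
      unfolding \<sigma>_eq[OF xy(1)] \<sigma>_eq[OF xy(2)] order[OF xy, symmetric] coset_le_iff[OF xy] ..
    with \<sigma> show ?hom by blast
  next
    assume ?hom
    then obtain \<sigma> where \<sigma>: "\<sigma> \<in> hom G real_group"
      and order: "\<And>x y. \<lbrakk>x \<in> carrier G; y \<in> carrier G\<rbrakk> \<Longrightarrow> x \<preceq> y \<longleftrightarrow> \<sigma> x \<le> \<sigma> y" by blast
    interpret \<sigma>: group_hom G real_group \<sigma>
      using \<sigma> by (simp add: group_hom_def group_hom_axioms_def group_real_group)
    have one: "\<sigma> \<one> = 0" using \<sigma>.hom_one by (simp add: real_group_def)
    have kernel: "kernel G real_group \<sigma> = C"
    proof (rule Set.set_eqI)
      fix x
      have "x \<in> carrier G \<Longrightarrow> \<sigma> x = 0 \<longleftrightarrow> x \<preceq> \<one> \<and> \<one> \<preceq> x"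
        using order[of x "\<one>"] order[of "\<one>" x] unfolding one by auto
      then show "x \<in> kernel G real_group \<sigma> \<longleftrightarrow> x \<in> C"
        by (auto simp: kernel_def mem_C real_group_def)
    qed
    \<comment> \<open>\<open>\<sigma>\<close> is constant on each coset, so its image there is a
      singleton.\<close>
    define \<tau> where "\<tau> X = the_elem (\<sigma> ` X)" for X
    have \<tau>: "\<tau> \<in> mon (G Mod C) real_group"
      using \<sigma>.FactGroup_hom \<sigma>.FactGroup_inj_on unfolding mon_def \<tau>_def[abs_def] kernel by simp
    have \<tau>_eq: "\<tau> (x <# C) = \<sigma> x" if x: "x \<in> carrier G" for x
    proof -
      have "\<sigma> y = \<sigma> x" if "y \<in> x <# C" for y
      proof (rule antisym)
        note y = mem_lcos[OF is_group preorder x that]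
        show "\<sigma> y \<le> \<sigma> x" using y(3) order[OF y(1) x] by blast
        show "\<sigma> x \<le> \<sigma> y" using y(2) order[OF x y(1)] by blast
      qed
      moreover have "x \<in> x <# C" using x subgroup_C by (rule lcos_self)
      ultimately have "\<sigma> ` (x <# C) = {\<sigma> x}" by blast
      then show ?thesis by (simp add: \<tau>_def)
    qed
    have "coset_le (\<preceq>) (x <# C) (y <# C) \<longleftrightarrow> \<tau> (x <# C) \<le> \<tau> (y <# C)"
      if xy: "x \<in> carrier G" "y \<in> carrier G" for x y
      unfolding \<tau>_eq[OF xy(1)] \<tau>_eq[OF xy(2)] order[OF xy, symmetric] coset_le_iff[OF xy] ..
    with \<tau> show ?mon by blast
  }
qed

text \<open>This is \<open>mon_quotient_iff_hom\<close> inside the group \<open>L\<close>; cosets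
  formed there agree with those formed in \<open>G\<close>, because multiplication is the
  same.\<close>

lemma convex_jump_embedding_iff:
  assumes jump: "convex_jump G (\<preceq>) K L" and "K \<lhd> G\<lparr>carrier := L\<rparr>"
  shows "(\<exists>\<tau>\<in>mon (G\<lparr>carrier := L\<rparr> Mod K) real_group. \<forall>x\<in>L. \<forall>y\<in>L.
        coset_le (induced_preorder G (\<preceq>) K L) (x <# K) (y <# K) \<longleftrightarrow> \<tau> (x <# K) \<le> \<tau> (y <# K))
    \<longleftrightarrow> (\<exists>\<sigma>\<in>hom (G\<lparr>carrier := L\<rparr>) real_group. \<forall>x\<in>L. \<forall>y\<in>L.
        induced_preorder G (\<preceq>) K L x y \<longleftrightarrow> \<sigma> x \<le> \<sigma> y)"
proof -
  let ?L = "G\<lparr>carrier := L\<rparr>"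
  have K: "convex_subgroup G (\<preceq>) K" and L: "convex_subgroup G (\<preceq>) L" and KL: "K \<subset> L"
    using jump by (auto simp: convex_jump_def)
  have "relative_left_preorder ?L K (induced_preorder G (\<preceq>) K L)"
  proof (intro relative_left_preorder.intro relative_left_preorder_axioms.intro)
    show "group ?L" by (rule subgroup.subgroup_is_group[OF convex_subgroupD(1)[OF L] is_group])
    show "left_preorder_rel ?L K (induced_preorder G (\<preceq>) K L)"
      by (rule induced_preorder_left_preorder(1)[OF is_group preorder K L KL])
  qed
  from relative_left_preorder.mon_quotient_iff_hom[OF this assms(2)]
  show ?thesis by (simp add: l_coset_def)
qed

end

theorem theorem1p7:
  fixes G :: "('a, 'm) monoid_scheme" (structure)
    and C :: "'a set"
    and lp :: "'a \<Rightarrow> 'a \<Rightarrow> bool"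
  assumes "group G"
    and "subgroup C G" and "C \<noteq> carrier G"
    and "left_preorder_rel G C lp"
  shows
    "((\<forall>K L. convex_jump G lp K L \<longrightarrow>
         K \<lhd> G\<lparr>carrier := L\<rparr> \<and>
         (\<exists>\<tau> \<in> mon (G\<lparr>carrier := L\<rparr> Mod K) real_group.
            \<forall>\<alpha>\<in>L. \<forall>\<beta>\<in>L.
              coset_le (induced_preorder G lp K L) (\<alpha> <#\<^bsub>G\<^esub> K) (\<beta> <#\<^bsub>G\<^esub> K)
                \<longleftrightarrow> \<tau> (\<alpha> <#\<^bsub>G\<^esub> K) \<le> \<tau> (\<beta> <#\<^bsub>G\<^esub> K)))
      \<longleftrightarrow>
      (\<forall>\<alpha>\<in>positive_cone G lp. \<forall>\<beta>\<in>positive_cone G lp.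
         strict lp \<alpha> (\<beta> \<otimes> (\<alpha> [^] (2::nat)))))
     \<and>
     ((\<forall>\<alpha>\<in>positive_cone G lp. \<forall>\<beta>\<in>positive_cone G lp.
         strict lp \<alpha> (\<beta> \<otimes> (\<alpha> [^] (2::nat))))
      \<longleftrightarrow>
      \<not> (\<exists>\<alpha> \<beta> u v w.
            crossing G (lcosets C) (coset_le lp) (left_mult_action G C) \<alpha> \<beta> u v w))
     \<and>
     (\<not> (\<exists>\<alpha> \<beta> u v w.
            crossing G (lcosets C) (coset_le lp) (left_mult_action G C) \<alpha> \<beta> u v w)
      \<longleftrightarrow>
      conradian G lp)"
proof -
  interpret relative_left_preorder G C lp
    using assms by (simp add: relative_left_preorder_def relative_left_preorder_axioms_def)
  have "(\<forall>K L. convex_jump G lp K L \<longrightarrow>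
         K \<lhd> G\<lparr>carrier := L\<rparr> \<and>
         (\<exists>\<tau> \<in> mon (G\<lparr>carrier := L\<rparr> Mod K) real_group.
            \<forall>\<alpha>\<in>L. \<forall>\<beta>\<in>L.
              coset_le (induced_preorder G lp K L) (\<alpha> <# K) (\<beta> <# K)
                \<longleftrightarrow> \<tau> (\<alpha> <# K) \<le> \<tau> (\<beta> <# K))) \<longleftrightarrow> square_property"
    (is "?quotients \<longleftrightarrow> _")
  proof
    assume q: ?quotients
    show square_property
    proof (rule real_embeddings_imp_square_property)
      fix K L assume jump: "convex_jump G lp K L"
      then show "\<exists>\<tau>\<in>hom (G\<lparr>carrier := L\<rparr>) real_group.
          \<forall>x\<in>L. \<forall>y\<in>L. induced_preorder G lp K L x y \<longleftrightarrow> \<tau> x \<le> \<tau> y"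
        using q convex_jump_embedding_iff[OF jump] by simp
    qed
  next
    assume square_property
    then show ?quotients
      by (intro allI impI conjI) (simp_all add: convex_jump_normal_hoelder convex_jump_embedding_iff)
  qed
  \<comment> \<open>The three implications close a cycle: no crossing, square property, Conradian,
    no crossing.\<close>
  moreover have "square_property \<longleftrightarrow> \<not> has_crossing" "\<not> has_crossing \<longleftrightarrow> conradian G lp"
    using no_crossing_imp_square_property square_property_imp_conradian crossing_imp_not_conradian
    by blast+
  ultimately show ?thesis unfolding square_property_def by blast
qed

end
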